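(* Consider the convex game and the asymmetric learning algorithm (both described in the context), and assume the following. (i) For each $i\in\mathcal N$, $\mathcal C_i(x_i,x_{-i})$ is convex in $x_i$ for all $x_{-i}\in\mathcal X_{-i}=\prod_{j\ne i}\mathcal X_j$. Moreover each $\mathcal X_i$ contains the ball of radius $r>0$ centered at the origin and has bounded diameter $D>0$. (ii) There is $U>0$ such that $|\mathcal C_i(x)|\le U$ for all $i\in\mathcal N$ and $x\in\mathcal X$. (iii) There is $L_0>0$ such that $|\mathcal C_i(x)-\mathcal C_i(y)|\le L_0\|x-y\|$ for all $i\in\mathcal N$ and $x,y\in\mathcal X$. Select, for all $t\ge 1$, $$\delta_t=\frac{1}{N_z^{1/4}t^{1/4}},\qquad \eta_{z,t}=\frac{1}{N_z^{1/4}t^{3/4}},\qquad \eta_{f,t}=\frac{1}{\sqrt t}.$$ Then, for any $T\ge 1$, the algorithm achieves regrets $$\mathrm R_{i_z}(T)=\mathcal O\big(N_z^{1/4}T^{3/4}\big)\quad\text{for all } i_z\in\mathcal N_z,$$ $$\mathrm R_{i_f}(T)=\mathcal O\big(T^{1/2}\big)\quad\text{for all } i_f\in\mathcal N_f,$$ where $\mathcal O$ hides all constant factors except for $N$, $N_z$ and $T$. That is, the hidden constants may depend on $d,D,r,U,L_0$ but not on $N,N_z,T$.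
   Context: **Game.** There are $N$ agents, $\mathcal N=\{1,\dots,N\}$. Agent $i$ chooses $x_i\in\mathcal X_i$, where $\mathcal X_i\subset\mathbb R^d$ ($d>0$) is a closed convex set. The joint action space is $\mathcal X=\prod_{i=1}^N\mathcal X_i$. Agent $i$ has cost $\mathcal C_i:\mathcal X\to\mathbb R$, written $\mathcal C_i(x)=\mathcal C_i(x_i,x_{-i})$, where $x_{-i}$ collects the actions of all agents other than $i$. Each agent wants to minimize $\mathcal C_i(x_i,x_{-i})$ over $x_i\in\mathcal X_i$. $\nabla_i\mathcal C_i$ denotes the gradient of $\mathcal C_i$ with respect to $x_i$, assumed to exist wherever it is used. $\|\cdot\|$ is the Euclidean norm. The order in which blocks of actions are listed as arguments of $\mathcal C_i$ is immaterial. **Two kinds of agents.** Let $0\le N_z\le N$. Agents in $\mathcal N_z=\{1,\dots,N_z\}$ have access only to zeroth-order oracles (values of their cost). Agents in $\mathcal N_f=\{N_z+1,\dots,N\}$ have first-order gradient information. (If $N_z=0$ then $\mathcal N_z=\emptyset$; if $N_z=N$ then $\mathcal N_f=\emptyset$.) Write $x_z=(x_1,\dots,x_{N_z})$ and $x_f=(x_{N_z+1},\dots,x_N)$. The subscript $-i_z$ denotes all agents in $\mathcal N_z$ except $i_z$. The subscript $-i_f$ denotes all agents in $\mathcal N_f$ except $i_f$. **Asymmetric learning algorithm.** The inputs are positive sequences $\eta_{f,t},\eta_{z,t},\delta_t$ and an initial (deterministic) point $x_1\in\mathcal X$. For $0<\delta<r$ put $\mathcal X_{i}^{\delta}=\{x_i\in\mathcal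 X_i:\ \tfrac{1}{1-\delta/r}x_i\in\mathcal X_i\}$. $\mathcal P_K$ denotes Euclidean projection onto $K$. $\mathbb S$ is the unit sphere in $\mathbb R^d$. At each episode $t=1,\dots,T$: 1. Each $i_z\in\mathcal N_z$ samples $u_{i_z,t}$ uniformly from $\mathbb S$ (independently across agents and episodes) and plays $\hat x_{i_z,t}=x_{i_z,t}+\delta_t u_{i_z,t}$. Each $i_f\in\mathcal N_f$ plays $x_{i_f,t}$. Write $\hat x_{z,t}=(\hat x_{1,t},\dots,\hat x_{N_z,t})$ and $x_{f,t}=(x_{N_z+1,t},\dots,x_{N,t})$. 2. Each $i_z$ observes $\mathcal C_{i_z}(\hat x_{z,t},x_{f,t})$. Each $i_f$ observes $\nabla_{i_f}\mathcal C_{i_f}(x_{f,t},\hat x_{z,t})$. 3. Updates: $x_{i_z,t+1}=\mathcal P_{\mathcal X_{i_z}^{\delta_t}}\big(x_{i_z,t}-\eta_{z,t}g_{i_z,t}\big)$ with $g_{i_z,t}=\frac{d}{\delta_t}\mathcal C_{i_z}(\hat x_{z,t},x_{f,t})\,u_{i_z,t}$, and $x_{i_f,t+1}=\mathcal P_{\mathcal X_{i_f}}\big(x_{i_f,t}-\eta_{f,t}\nabla_{i_f}\mathcal C_{i_f}(x_{f,t},\hat x_{z,t})\big)$. The played actions are required to be feasible: when $N_z\geq 1$, $\delta_t<r$ for all $t$ and $x_{i_z,1}\in\mathcal X_{i_z}^{\delta_1}$ for $i_z\in\mathcal N_z$. If $N_z=0$, the sequences $\delta_t,\eta_{z,t}$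 are not used and the claim about $\mathcal N_z$ is vacuous. **Regret.** For $i_z\in\mathcal N_z$, $$\mathrm R_{i_z}(T)=\mathbb E\Big[\sum_{t=1}^T\mathcal C_{i_z}(\hat x_{z,t},x_{f,t})-\min_{x_{i_z}\in\mathcal X_{i_z}}\sum_{t=1}^T\mathcal C_{i_z}(x_{i_z},\hat x_{-i_z,t},x_{f,t})\Big].$$ For $i_f\in\mathcal N_f$, $$\mathrm R_{i_f}(T)=\mathbb E\Big[\sum_{t=1}^T\mathcal C_{i_f}(x_{f,t},\hat x_{z,t})-\min_{x_{i_f}\in\mathcal X_{i_f}}\sum_{t=1}^T\mathcal C_{i_f}(x_{i_f},x_{-i_f,t},\hat x_{z,t})\Big].$$ Expectations are over the random directions $u_{i_z,t}$. *)

theory Defs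
  imports "HOL-Probability.Probability"
begin

(* A joint action is an extensional function on the agents {1..N}, so that N can be
   quantified inside a statement.  The Euclidean norm on (R^d)^N becomes an L2_set. *)

definition joint_actions :: "nat \<Rightarrow> (nat \<Rightarrow> (real^'d) set) \<Rightarrow> (nat \<Rightarrow> real^'d) set" where
  "joint_actions N X = Pi\<^sub>E {1..N} X"

definition joint_dist :: "nat \<Rightarrow> (nat \<Rightarrow> real^'d) \<Rightarrow> (nat \<Rightarrow> real^'d) \<Rightarrow> real" where
  "joint_dist N x y = L2_set (\<lambda>i. norm (x i - y i)) {1..N}"

(* The uniform distribution on the unit sphere is the law of v / |v| for v uniform on the
   unit ball (sgn v = v / norm v); see prob_space_sphere_uniform and
   sphere_uniform_orthogonal_invariant below. *)
definition sphere_uniform :: "(real^'d) measure" where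
  "sphere_uniform =
     restrict_space (distr (uniform_measure lborel (ball 0 1)) borel sgn) (sphere 0 1)"

(* Sample space of the directions: u (i, t) is the direction of agent i at episode t. *)
definition directions :: "nat \<Rightarrow> (nat \<times> nat \<Rightarrow> real^'d) measure" where
  "directions Nz = Pi\<^sub>M ({1..Nz} \<times> {1..}) (\<lambda>_. sphere_uniform)"

(* Gradient relative to S: it only uses the values of f on S, so that it makes sense at
   boundary points of an action set.  It is unique for convex S with nonempty interior,
   see gradient_within_eq below. *)
definition gradient_within :: "(real^'d \<Rightarrow> real) \<Rightarrow> real^'d \<Rightarrow> (real^'d) set \<Rightarrow> real^'d" where
  "gradient_within f a S = (THE g. (f has_derivative (\<lambda>h. h \<bullet> g)) (at a within S))"

definition shrunk :: "real \<Rightarrow> real \<Rightarrow> (real^'d) set \<Rightarrow> (real^'d) set" where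
  "shrunk r \<delta> S = {a \<in> S. (1 / (1 - \<delta> / r)) *\<^sub>R a \<in> S}"

definition perturb ::
  "nat \<Rightarrow> nat \<Rightarrow> real \<Rightarrow> (nat \<Rightarrow> real^'d) \<Rightarrow> (nat \<Rightarrow> real^'d) \<Rightarrow> (nat \<Rightarrow> real^'d)" where
  "perturb N Nz \<delta> v x = (\<lambda>i\<in>{1..N}. if i \<le> Nz then x i + \<delta> *\<^sub>R v i else x i)"

definition update ::
  "real \<Rightarrow> nat \<Rightarrow> nat \<Rightarrow> (nat \<Rightarrow> (real^'d) set) \<Rightarrow> (nat \<Rightarrow> (nat \<Rightarrow> real^'d) \<Rightarrow> real) \<Rightarrow>
   real \<Rightarrow> real \<Rightarrow> real \<Rightarrow> (nat \<Rightarrow> real^'d) \<Rightarrow> (nat \<Rightarrow> real^'d) \<Rightarrow> (nat \<Rightarrow> real^'d)" where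
  "update r N Nz X C \<delta> \<eta>z \<eta>f v x =
     (let y = perturb N Nz \<delta> v x in
      (\<lambda>i\<in>{1..N}.
        if i \<le> Nz
        then closest_point (shrunk r \<delta> (X i))
               (x i - \<eta>z *\<^sub>R ((real CARD('d) / \<delta> * C i y) *\<^sub>R v i))
        else closest_point (X i)
               (x i - \<eta>f *\<^sub>R gradient_within (\<lambda>a. C i (y(i := a))) (y i) (X i))))"

(* Episodes are numbered from 1; the value at 0 is never used. *)
primrec iterate ::
  "real \<Rightarrow> nat \<Rightarrow> nat \<Rightarrow> (nat \<Rightarrow> (real^'d) set) \<Rightarrow> (nat \<Rightarrow> (nat \<Rightarrow> real^'d) \<Rightarrow> real) \<Rightarrow>
   (nat \<Rightarrow> real) \<Rightarrow> (nat \<Rightarrow> real) \<Rightarrow> (nat \<Rightarrow> real) \<Rightarrow> (nat \<Rightarrow> real^'d) \<Rightarrow>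
   (nat \<times> nat \<Rightarrow> real^'d) \<Rightarrow> nat \<Rightarrow> (nat \<Rightarrow> real^'d)" where
  "iterate r N Nz X C \<delta> \<eta>z \<eta>f x1 u 0 = x1"
| "iterate r N Nz X C \<delta> \<eta>z \<eta>f x1 u (Suc t) =
     (if t = 0 then x1
      else update r N Nz X C (\<delta> t) (\<eta>z t) (\<eta>f t) (\<lambda>i. u (i, t))
             (iterate r N Nz X C \<delta> \<eta>z \<eta>f x1 u t))"

definition played ::
  "real \<Rightarrow> nat \<Rightarrow> nat \<Rightarrow> (nat \<Rightarrow> (real^'d) set) \<Rightarrow> (nat \<Rightarrow> (nat \<Rightarrow> real^'d) \<Rightarrow> real) \<Rightarrow>
   (nat \<Rightarrow> real) \<Rightarrow> (nat \<Rightarrow> real) \<Rightarrow> (nat \<Rightarrow> real) \<Rightarrow> (nat \<Rightarrow> real^'d) \<Rightarrow>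
   (nat \<times> nat \<Rightarrow> real^'d) \<Rightarrow> nat \<Rightarrow> (nat \<Rightarrow> real^'d)" where
  "played r N Nz X C \<delta> \<eta>z \<eta>f x1 u t =
     perturb N Nz (\<delta> t) (\<lambda>i. u (i, t)) (iterate r N Nz X C \<delta> \<eta>z \<eta>f x1 u t)"

(* The same expression serves both kinds of agents.  For compact X i and continuous C i the
   infimum is a minimum. *)
definition regret ::
  "real \<Rightarrow> nat \<Rightarrow> nat \<Rightarrow> (nat \<Rightarrow> (real^'d) set) \<Rightarrow> (nat \<Rightarrow> (nat \<Rightarrow> real^'d) \<Rightarrow> real) \<Rightarrow>
   (nat \<Rightarrow> real) \<Rightarrow> (nat \<Rightarrow> real) \<Rightarrow> (nat \<Rightarrow> real) \<Rightarrow> (nat \<Rightarrow> real^'d) \<Rightarrow> nat \<Rightarrow> nat \<Rightarrow> real" where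
  "regret r N Nz X C \<delta> \<eta>z \<eta>f x1 i T =
     (LINT u|directions Nz.
        (\<Sum>t=1..T. C i (played r N Nz X C \<delta> \<eta>z \<eta>f x1 u t))
        - (INF a\<in>X i. \<Sum>t=1..T. C i ((played r N Nz X C \<delta> \<eta>z \<eta>f x1 u t)(i := a))))"

lemma gradient_within_eq:
  fixes S :: "(real^'d) set"
  assumes "convex S" "interior S \<noteq> {}" "a \<in> S"
    and g: "(f has_derivative (\<lambda>h. h \<bullet> g)) (at a within S)"
  shows "gradient_within f a S = g"
  unfolding gradient_within_def
proof (rule the_equality)
  show "(f has_derivative (\<lambda>h. h \<bullet> g)) (at a within S)" by (fact g)
next
  fix g' assume g': "(f has_derivative (\<lambda>h. h \<bullet> g')) (at a within S)"
  define w where "w = g' - g"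
  have zero: "((\<lambda>_. 0) has_derivative (\<lambda>h. h \<bullet> w)) (at a within S)"
    using has_derivative_diff[OF g' g] by (simp add: w_def inner_diff_right)
  have orth: "(b - a) \<bullet> w = 0" if "b \<in> S" for b
  proof -
    have path: "((\<lambda>t. a + t *\<^sub>R (b - a)) has_derivative (\<lambda>t. t *\<^sub>R (b - a))) (at 0 within {0..1})"
      by (auto intro!: derivative_eq_intros)
    have "(\<lambda>t. a + t *\<^sub>R (b - a)) ` {0..1} \<subseteq> S"
    proof clarify
      fix t :: real assume "t \<in> {0..1}"
      then have "(1 - t) *\<^sub>R a + t *\<^sub>R b \<in> S"
        using convexD[OF \<open>convex S\<close> \<open>a \<in> S\<close> that, of "1 - t" t] by auto
      then show "a + t *\<^sub>R (b - a) \<in> S" by (simp add: algebra_simps)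
    qed
    then have "((\<lambda>_. 0::real) has_derivative (\<lambda>t. (t *\<^sub>R (b - a)) \<bullet> w)) (at 0 within {0..1})"
      using has_derivative_in_compose[OF path, of "\<lambda>_. 0" "\<lambda>h. h \<bullet> w"]
        has_derivative_subset[OF zero] by simp
    then have "((\<lambda>_. 0::real) has_vector_derivative ((b - a) \<bullet> w)) (at 0 within {0..1})"
      by (simp add: has_vector_derivative_def)
    then show ?thesis
      using vector_derivative_unique_within_closed_interval[of 0 1 0 "\<lambda>_. 0::real" "(b - a) \<bullet> w" 0]
      by (simp add: has_vector_derivative_const)
  qed
  obtain c e where e: "e > 0" "cball c e \<subseteq> S"
    using \<open>interior S \<noteq> {}\<close> by (auto simp: mem_interior_cball)
  show "g' = g"
  proof (rule ccontr)
    assume "g' \<noteq> g"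
    then have w: "norm w > 0" by (simp add: w_def)
    define b where "b = c + (e / norm w) *\<^sub>R w"
    have "b \<in> S" "c \<in> S" using e w by (auto simp: b_def dist_norm subset_iff)
    then have "(b - c) \<bullet> w = 0" using orth[of b] orth[of c] by (simp add: inner_diff_left)
    then show False using e w by (simp add: b_def)
  qed
qed

lemma emeasure_unit_ball:
  "emeasure lborel (ball (0 :: real^'d) 1) \<noteq> 0" "emeasure lborel (ball (0 :: real^'d) 1) \<noteq> \<infinity>"
proof -
  have "measure lborel (ball (0 :: real^'d) 1) > 0"
    by (rule content_ball_pos) simp
  then show "emeasure lborel (ball (0 :: real^'d) 1) \<noteq> 0"
    by (auto simp: measure_def)
  show "emeasure lborel (ball (0 :: real^'d) 1) \<noteq> \<infinity>"
    using emeasure_bounded_finite[OF bounded_ball] by (metis infinity_ennreal_def less_irrefl)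
qed

lemma sphere_uniform_measure:
  fixes A :: "(real^'d) set"
  assumes "A \<in> sets borel" "A \<subseteq> sphere 0 1"
  shows "emeasure sphere_uniform A =
    emeasure lborel (ball 0 1 \<inter> sgn -` A) / emeasure lborel (ball (0 :: real^'d) 1)"
proof -
  have "sgn -` A \<in> sets borel"
    using measurable_sets[OF borel_measurable_sgn assms(1)] by simp
  then show ?thesis
    using assms
    by (simp add: sphere_uniform_def emeasure_restrict_space emeasure_distr)
qed

lemma prob_space_sphere_uniform: "prob_space (sphere_uniform :: (real^'d) measure)"
proof
  have sp: "space (sphere_uniform :: (real^'d) measure) = sphere 0 1"
    by (simp add: sphere_uniform_def space_restrict_space)
  have *: "ball (0 :: real^'d) 1 \<inter> sgn -` sphere 0 1 = ball 0 1 - {0}"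
    by (auto simp: norm_sgn)
  have "emeasure lborel (ball (0 :: real^'d) 1 - {0}) = emeasure lborel (ball (0 :: real^'d) 1)"
    by (subst emeasure_Diff) auto
  then show "emeasure sphere_uniform (space (sphere_uniform :: (real^'d) measure)) = 1"
    unfolding sp using emeasure_unit_ball[where 'd='d]
    by (subst sphere_uniform_measure) (auto simp: * ennreal_divide_self less_top)
qed

(* The sort wellorder is inherited from measure_orthogonal_image. *)
lemma sphere_uniform_orthogonal_invariant:
  fixes f :: "real^'m::{finite,wellorder} \<Rightarrow> real^'m::{finite,wellorder}" and A :: "(real^'m::{finite,wellorder}) set"
  assumes f: "orthogonal_transformation f" and A: "A \<in> sets borel" "A \<subseteq> sphere 0 1"
  shows "emeasure sphere_uniform (f -` A) = emeasure sphere_uniform A"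
proof -
  have lin: "linear f" and nrm: "\<And>x. norm (f x) = norm x"
    using f by (auto simp: orthogonal_transformation orthogonal_transformation_norm)
  have cont: "continuous_on UNIV f"
    using lin by (simp add: linear_continuous_on linear_linear)
  have vA: "f -` A \<in> sets borel"
    using measurable_sets[OF borel_measurable_continuous_onI[OF cont] A(1)] by simp
  have sub: "f -` A \<subseteq> sphere 0 1" using A(2) nrm by auto
  have sgnf: "sgn (f x) = f (sgn x)" for x
    by (simp add: sgn_div_norm nrm linear_scale[OF lin])
  define B where "B = ball (0 :: real^'m::{finite,wellorder}) 1 \<inter> sgn -` (f -` A)"
  have fB: "f ` B = ball 0 1 \<inter> sgn -` A"
  proof
    show "f ` B \<subseteq> ball 0 1 \<inter> sgn -` A" by (auto simp: B_def sgnf nrm)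
    show "ball 0 1 \<inter> sgn -` A \<subseteq> f ` B"
    proof
      fix y assume y: "y \<in> ball 0 1 \<inter> sgn -` A"
      obtain x where "y = f x" using orthogonal_transformation_surj[OF f] by (metis surjD)
      with y show "y \<in> f ` B" by (auto simp: B_def sgnf nrm)
    qed
  qed
  have meas: "ball 0 1 \<inter> sgn -` E \<in> sets borel" if "E \<in> sets borel" for E :: "(real^'m::{finite,wellorder}) set"
    using measurable_sets[OF borel_measurable_sgn that] by simp
  have Bm: "B \<in> sets borel" "f ` B \<in> sets borel"
    unfolding fB using meas[OF vA] meas[OF A(1)] by (auto simp: B_def)
  have bd: "bounded B" "bounded (f ` B)" unfolding fB by (auto simp: B_def bounded_Int)
  have Bl: "B \<in> lmeasurable"
    by (rule bounded_set_imp_lmeasurable) (use bd Bm in auto)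
  have "measure lebesgue (f ` B) = measure lebesgue B"
    by (rule measure_orthogonal_image[OF f Bl])
  then have "measure lborel (f ` B) = measure lborel B"
    using Bm by (simp add: measure_completion)
  then have "emeasure lborel (f ` B) = emeasure lborel B"
    using emeasure_bounded_finite[OF bd(1)] emeasure_bounded_finite[OF bd(2)]
    by (simp add: emeasure_eq_ennreal_measure less_top)
  then show ?thesis
    using sphere_uniform_measure[OF vA sub] sphere_uniform_measure[OF A] fB B_def by simp
qed

end

theory Submission
  imports Defs
begin

text \<open>
  Conditionally on all other directions, the
  estimate \<open>g = (d / \<delta>) f (x + \<delta> u) u\<close> has as its mean the gradient of the average of \<open>f\<close> over the ball
  of radius \<open>\<delta>\<close>, which is an approximate subgradient of \<open>f\<close> with error \<open>2 L \<delta>\<close>. Instead of the divergence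
  theorem we use the convexity inequality integrated against the kernel \<open>max 0 (1 - |v|) - max 0 (c - |v|)\<close>:
  its directional derivative is carried by the shell \<open>c < |v| < 1\<close>, and as \<open>c\<close> tends to 1 the shell
  integral of a homogeneous function turns into an integral over the sphere by scaling.

  Projected descent against the moving comparator \<open>(1 - \<delta>\<^sub>t / r) a\<close> gives the regret up to the noise
  \<open>\<xi>\<^sub>t = g\<^sub>t - E g\<^sub>t\<close>. Because the minimum stands inside the expectation, the comparator depends on the
  noise, so \<open>E |\<Sum> (1 - \<delta>\<^sub>t / r) \<xi>\<^sub>t|\<close> has to be bounded; by orthogonality of the martingale differences
  it is at most the square root of \<open>\<Sum> E |\<xi>\<^sub>t|\<^sup>2\<close>, which is of the same order \<open>N\<^sub>z\<^sup>1\<^sup>/\<^sup>4 T\<^sup>3\<^sup>/\<^sup>4\<close>.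
  Each coordinate's effect is isolated by resampling it, so no conditional expectations are needed.
  For first-order agents the usual projected gradient argument holds for every realisation.
\<close>

subsection \<open>The mean of the one-point gradient estimate\<close>

text \<open>The constants are free of \<open>N\<close> because each regret freezes the other agents
  at the actions they really played. Costs are compared only at joint actions that differ in the
  block of agent \<open>i\<close>, where \<open>joint_dist\<close> is the norm of that block, so
  neither the number of agents nor the perturbations of the others enter an error term.
  \<open>Nz\<close> enters only through the parameters, and these balance with
  \<open>n = Nz powr (1/4)\<close>: the bias terms are multiples of \<open>\<delta> t\<close>, which
  is at most \<open>n * t powr (-1/4)\<close>; the squared gradient estimates weighted by
  \<open>\<eta>z t\<close> have the same order; telescoping costs
  \<open>1 / \<eta>z T = n * T powr (3/4)\<close>; the noise has second moment of order
  \<open>1 / (\<delta> t)^2 = n^2 * t powr (1/2)\<close>, which sums to the order of the square of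
  \<open>n * T powr (3/4)\<close>.

  A kernel built from cones is used because it is Lipschitz: the difference quotients of its
  translates stay bounded and converge almost everywhere, whereas those of the indicator of a ball
  concentrate on a surface.\<close>

lemma measurable_pred_ball [measurable]: "Measurable.pred borel (\<lambda>x. x \<in> ball c r)"
  by (simp add: pred_def del: mem_ball)

lemma measurable_pred_sphere [measurable]: "Measurable.pred borel (\<lambda>x::'a::euclidean_space. x \<in> sphere c r)"
  using borel_closed[OF closed_sphere, of c r] by (simp add: pred_def del: mem_sphere)

lemma lborel_integral_affine:
  fixes g :: "'a::euclidean_space \<Rightarrow> real"
  assumes "c \<noteq> 0" and g[measurable]: "g \<in> borel_measurable borel"
  shows "(\<integral>v. g v \<partial>lborel) = \<bar>c\<bar> ^ DIM('a) * (\<integral>v. g (t + c *\<^sub>R v) \<partial>lborel)"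
proof -
  have "(\<integral>v. g v \<partial>lborel) = (\<integral>v. g v \<partial>density (distr lborel borel (\<lambda>x. t + c *\<^sub>R x)) (\<lambda>_. ennreal (\<bar>c\<bar> ^ DIM('a))))"
    using lborel_affine[OF assms(1), of t] by (simp add: ennreal_power)
  also have "\<dots> = \<bar>c\<bar> ^ DIM('a) * (\<integral>v. g (t + c *\<^sub>R v) \<partial>lborel)"
    by (subst integral_density) (auto simp: integral_distr)
  finally show ?thesis .
qed

lemma lborel_integral_translate:
  fixes g :: "'a::euclidean_space \<Rightarrow> real"
  assumes "g \<in> borel_measurable borel"
  shows "(\<integral>v. g (v + t) \<partial>lborel) = (\<integral>v. g v \<partial>lborel)"
  using lborel_integral_affine[of 1 g t] assms by (simp add: add.commute)

lemma integrable_continuous_bounded_support: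
  fixes g :: "'a::euclidean_space \<Rightarrow> real"
  assumes g: "continuous_on UNIV g" and "\<And>v. norm v > R \<Longrightarrow> g v = 0"
  shows "integrable lborel g"
proof -
  have "integrable lborel (\<lambda>v. indicator (cball 0 R) v *\<^sub>R g v)"
    by (intro borel_integrable_compact continuous_on_subset[OF g]) auto
  also have "(\<lambda>v. indicator (cball 0 R) v *\<^sub>R g v) = g"
    using assms(2) by (auto simp: fun_eq_iff indicator_def)
  finally show ?thesis .
qed

lemma measure_unit_ball_pos: "measure lborel (ball (0 :: 'a::euclidean_space) 1) > 0"
  by (rule content_ball_pos) simp

text \<open>\<open>sgn\<close> carries the uniform law of the ball to the sphere. The restriction to
  the sphere discards only the origin, where \<open>sgn\<close> is 0, and a single point is
  null.\<close>

lemma sphere_uniform_integral: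
  fixes F :: "real^'d \<Rightarrow> real"
  assumes [measurable]: "F \<in> borel_measurable borel"
  shows "(\<integral>u. F u \<partial>sphere_uniform)
    = (\<integral>v. indicator (ball 0 1) v * F (sgn v) \<partial>lborel) / measure lborel (ball (0::real^'d) 1)"
proof -
  let ?b = "emeasure lborel (ball (0::real^'d) 1)"
  let ?m = "measure lborel (ball (0::real^'d) 1)"
  have b: "?b = ennreal ?m"
    using emeasure_unit_ball(2)[where 'd='d] by (simp add: emeasure_eq_ennreal_measure less_top)
  have um: "uniform_measure lborel (ball (0::real^'d) 1) = density lborel (\<lambda>v. ennreal (indicator (ball 0 1) v / ?m))"
    unfolding uniform_measure_def
    using measure_unit_ball_pos[where 'a="real^'d"]
    by (intro density_cong) (auto simp: b indicator_def divide_ennreal ennreal_1[symmetric] simp del: ennreal_1)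
  have "(\<integral>u. F u \<partial>sphere_uniform) =
    (\<integral>u. indicator (sphere 0 1) u *\<^sub>R F u \<partial>distr (uniform_measure lborel (ball (0::real^'d) 1)) borel sgn)"
    unfolding sphere_uniform_def by (rule integral_restrict_space) auto
  also have "\<dots> = (\<integral>v. indicator (sphere 0 1) (sgn v) *\<^sub>R F (sgn v) \<partial>uniform_measure lborel (ball (0::real^'d) 1))"
    by (rule integral_distr) measurable
  also have "\<dots> = (\<integral>v. (indicator (ball 0 1) v / ?m) *\<^sub>R (indicator (sphere 0 1) (sgn v) *\<^sub>R F (sgn v)) \<partial>lborel)"
    unfolding um
  proof (rule integral_density)
    show "(\<lambda>v. indicator (sphere 0 1) (sgn v) *\<^sub>R F (sgn v)) \<in> borel_measurable lborel" by measurable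
    show "(\<lambda>v. indicator (ball 0 1) v / ?m) \<in> borel_measurable (lborel :: (real^'d) measure)" by measurable
  qed simp
  also have "\<dots> = (\<integral>v. (indicator (ball 0 1) v * F (sgn v)) / ?m \<partial>lborel)"
  proof (rule integral_cong_AE)
    have "AE v in lborel. v \<noteq> (0::real^'d)" by (rule AE_lborel_singleton)
    then show "AE v in lborel. (indicator (ball 0 1) v / ?m) *\<^sub>R (indicator (sphere 0 1) (sgn v) *\<^sub>R F (sgn v))
       = (indicator (ball 0 1) v * F (sgn v)) / ?m"
      by eventually_elim (auto simp: norm_sgn)
  qed measurable
  finally show ?thesis by simp
qed

text \<open>\<open>G (sgn v)\<close> is homogeneous of degree 0, so dilation by \<open>c\<close>
  contributes only its Jacobian.\<close>

lemma integral_ball_sgn_scale: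
  fixes G :: "'a::euclidean_space \<Rightarrow> real"
  assumes "c > 0" and [measurable]: "G \<in> borel_measurable borel"
  shows "(\<integral>v. indicator (ball 0 c) v * G (sgn v) \<partial>lborel)
    = c ^ DIM('a) * (\<integral>v. indicator (ball 0 1) v * G (sgn v) \<partial>lborel)"
proof -
  have "(\<lambda>v. indicator (ball 0 c) v * G (sgn v)) \<in> borel_measurable borel" by measurable
  then have "(\<integral>v. indicator (ball 0 c) v * G (sgn v) \<partial>lborel)
      = c ^ DIM('a) * (\<integral>v. indicator (ball 0 c) (c *\<^sub>R v) * G (sgn (c *\<^sub>R v)) \<partial>(lborel :: 'a measure))"
    using lborel_integral_affine[of c "\<lambda>v. indicator (ball 0 c) v * G (sgn v)" 0] assms by simp
  also have "(\<lambda>v::'a. indicator (ball 0 c) (c *\<^sub>R v) * G (sgn (c *\<^sub>R v))) = (\<lambda>v. indicator (ball 0 1) v * G (sgn v))"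
    using assms(1) by (auto simp: fun_eq_iff indicator_def sgn_scaleR)
  finally show ?thesis .
qed

lemma measure_ball_scale:
  assumes "c > 0"
  shows "measure lborel (ball (0::'a::euclidean_space) c) = c ^ DIM('a) * measure lborel (ball (0::'a) 1)"
  using integral_ball_sgn_scale[OF assms, of "\<lambda>_::'a. 1"] by simp

text \<open>A 1-Lipschitz potential whose gradient is \<open>- sgn v\<close> inside the ball of
  radius \<open>c\<close> and 0 outside. In \<open>cone_kernel 1 v - cone_kernel c v\<close> the
  gradients cancel for \<open>norm v < c\<close>, which leaves the shell.\<close>

definition cone_kernel :: "real \<Rightarrow> 'a::real_normed_vector \<Rightarrow> real" where
  "cone_kernel c v = max 0 (c - norm v)"

lemma cone_kernel_measurable [measurable]:
  "cone_kernel c \<in> borel_measurable (borel :: 'a::euclidean_space measure)"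
  unfolding cone_kernel_def by measurable

lemma cone_kernel_lipschitz: "\<bar>cone_kernel c v - cone_kernel c w\<bar> \<le> norm (v - w)"
  unfolding cone_kernel_def using norm_triangle_ineq3[of v w] by linarith

text \<open>The two excluded places are the kinks of the kernel: the apex and the rim. The shift by
  minus \<open>q\<close> cancels the minus sign of the gradient.\<close>

lemma cone_kernel_difference_quotient:
  fixes v q :: "'a::euclidean_space"
  assumes "v \<noteq> 0" "norm v \<noteq> c"
  shows "(\<lambda>n. real (Suc n) * (cone_kernel c (v - q /\<^sub>R real (Suc n)) - cone_kernel c v))
    \<longlonglongrightarrow> (if norm v < c then sgn v \<bullet> q else 0)"
proof -
  have "((\<lambda>s. cone_kernel c (v - s *\<^sub>R q)) has_real_derivative (if norm v < c then sgn v \<bullet> q else 0)) (at 0)"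
  proof (cases "norm v < c")
    case True
    have "((\<lambda>s. v - s *\<^sub>R q) has_derivative (\<lambda>s. - (s *\<^sub>R q))) (at 0)"
      by (auto intro!: derivative_eq_intros)
    from has_derivative_compose[OF this, of norm "\<lambda>h. h \<bullet> sgn v"]
    have "((\<lambda>s. norm (v - s *\<^sub>R q)) has_derivative (\<lambda>s. - (s * (sgn v \<bullet> q)))) (at 0)"
      using has_derivative_norm[OF assms(1)] by (simp add: inner_commute)
    from has_derivative_diff[OF has_derivative_const this, of c]
    have "((\<lambda>s. c - norm (v - s *\<^sub>R q)) has_derivative (\<lambda>s. s * (sgn v \<bullet> q))) (at 0)"
      by simp
    then have "((\<lambda>s. cone_kernel c (v - s *\<^sub>R q)) has_derivative (\<lambda>s. s * (sgn v \<bullet> q))) (at 0)"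
    proof (rule has_derivative_transform_within_open)
      show "open {s. norm (v - s *\<^sub>R q) < c}"
        by (intro open_Collect_less continuous_intros)
    qed (use True in \<open>auto simp: cone_kernel_def\<close>)
    then show ?thesis using True
      by (simp add: has_field_derivative_def mult_commute_abs)
  next
    case False
    have "((\<lambda>s::real. 0::real) has_derivative (\<lambda>s. 0)) (at 0)" by simp
    then have "((\<lambda>s. cone_kernel c (v - s *\<^sub>R q)) has_derivative (\<lambda>s. 0)) (at 0)"
    proof (rule has_derivative_transform_within_open)
      show "open {s. norm (v - s *\<^sub>R q) > c}"
        by (intro open_Collect_less continuous_intros)
    qed (use False assms in \<open>auto simp: cone_kernel_def\<close>)
    moreover have "(\<lambda>s. 0) = (*) (0::real)" by (rule ext) simp
    ultimately show ?thesis using False by (simp only: has_field_derivative_def if_False)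
  qed
  then have lim: "((\<lambda>s. (cone_kernel c (v - s *\<^sub>R q) - cone_kernel c v) / s) \<longlongrightarrow> (if norm v < c then sgn v \<bullet> q else 0)) (at 0)"
    by (simp add: has_field_derivative_iff)
  have "filterlim (\<lambda>n. inverse (real (Suc n))) (at 0) sequentially"
    unfolding filterlim_at using LIMSEQ_inverse_real_of_nat by auto
  from filterlim_compose[OF lim this] show ?thesis
    by (simp add: divide_inverse mult.commute)
qed

text \<open>Dominated convergence: the Lipschitz bound keeps every quotient below
  \<open>norm q\<close>, and the kinks form a null set.\<close>

lemma cone_kernel_shift_integral:
  fixes h :: "'a::euclidean_space \<Rightarrow> real"
  assumes h: "continuous_on UNIV h" and c: "0 < c" "c \<le> 1"
  shows "(\<lambda>n. (\<integral>v. real (Suc n) * (cone_kernel c (v - q /\<^sub>R real (Suc n)) - cone_kernel c v) * h v \<partial>lborel))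
    \<longlonglongrightarrow> (\<integral>v. indicator (ball 0 c) v * (sgn v \<bullet> q) * h v \<partial>lborel)"
proof -
  have hm[measurable]: "h \<in> borel_measurable borel" by (rule borel_measurable_continuous_onI[OF h])
  \<comment> \<open>Outside this radius the kernel and all its translates vanish, since
    \<open>c \<le> 1\<close> and no shift is longer than \<open>norm q\<close>.\<close>
  let ?R = "1 + norm q"
  have "compact (h ` cball 0 ?R)"
    by (intro compact_continuous_image continuous_on_subset[OF h]) auto
  then obtain M where M: "\<And>v. v \<in> cball 0 ?R \<Longrightarrow> \<bar>h v\<bar> \<le> M"
    by (metis compact_imp_bounded bounded_real image_eqI)
  show ?thesis
  proof (rule integral_dominated_convergence)
    show "integrable lborel (\<lambda>v::'a. indicator (ball 0 ?R) v * (norm q * M) :: real)"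
      using emeasure_bounded_finite[OF bounded_ball, of "0::'a" ?R]
      by (intro integrable_mult_left integrable_real_indicator) auto
    have "AE v in lborel. v \<notin> sphere (0::'a) c"
      using negligible_sphere[of "0::'a" c]
      by (intro AE_not_in) (auto simp: null_sets_completion_iff negligible_iff_null_sets)
    moreover have "AE v in lborel. v \<noteq> (0::'a)" by (rule AE_lborel_singleton)
    ultimately show "AE v in lborel. (\<lambda>n. real (Suc n) * (cone_kernel c (v - q /\<^sub>R real (Suc n)) - cone_kernel c v) * h v)
      \<longlonglongrightarrow> indicator (ball 0 c) v * (sgn v \<bullet> q) * h v"
    proof eventually_elim
      case (elim v)
      show ?case
        using tendsto_mult_right[OF cone_kernel_difference_quotient[of v c q], of "h v"] elim
        by (auto simp: indicator_def split: if_splits)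
    qed
    fix n
    show "AE v in lborel. norm (real (Suc n) * (cone_kernel c (v - q /\<^sub>R real (Suc n)) - cone_kernel c v) * h v)
      \<le> indicator (ball 0 ?R) v * (norm q * M)"
    proof (rule AE_I2)
      fix v :: 'a
      have small: "norm (q /\<^sub>R real (Suc n)) \<le> norm q"
        using divide_left_mono[of 1 "real (Suc n)" "norm q"] by (simp add: inverse_eq_divide del: of_nat_Suc)
      show "norm (real (Suc n) * (cone_kernel c (v - q /\<^sub>R real (Suc n)) - cone_kernel c v) * h v)
          \<le> indicator (ball 0 ?R) v * (norm q * M)"
      proof (cases "v \<in> ball 0 ?R")
        case True
        have "\<bar>cone_kernel c (v - q /\<^sub>R real (Suc n)) - cone_kernel c v\<bar> \<le> norm q / real (Suc n)"
          using cone_kernel_lipschitz[of c "v - q /\<^sub>R real (Suc n)" v] by (simp add: divide_inverse mult.commute)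
        then have "real (Suc n) * \<bar>cone_kernel c (v - q /\<^sub>R real (Suc n)) - cone_kernel c v\<bar> \<le> norm q"
          by (simp add: field_simps)
        then have "real (Suc n) * \<bar>cone_kernel c (v - q /\<^sub>R real (Suc n)) - cone_kernel c v\<bar> * \<bar>h v\<bar> \<le> norm q * M"
          by (rule mult_mono) (use M[of v] True in auto)
        then show ?thesis using True by (simp add: abs_mult)
      next
        case False
        then have "norm v \<ge> 1 + norm q" by simp
        moreover have "norm (v - q /\<^sub>R real (Suc n)) \<ge> norm v - norm (q /\<^sub>R real (Suc n))"
          by (rule norm_triangle_ineq2)
        ultimately have "norm (v - q /\<^sub>R real (Suc n)) \<ge> c" "norm v \<ge> c"
          using small c norm_ge_zero[of q] by linarith+
        then show ?thesis using False by (simp add: cone_kernel_def)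
      qed
    qed
  qed measurable
qed

lemma continuous_cone_kernel [continuous_intros]:
  "continuous_on S g \<Longrightarrow> continuous_on S (\<lambda>v. cone_kernel c (g v))"
  unfolding cone_kernel_def by (intro continuous_intros)

lemma lipschitz_imp_continuous_on:
  fixes f :: "'a::real_normed_vector \<Rightarrow> real"
  assumes "\<And>y z. \<bar>f y - f z\<bar> \<le> L * norm (y - z)"
  shows "continuous_on S f"
proof -
  have "(\<bar>L\<bar>)-lipschitz_on S f"
  proof (rule lipschitz_onI)
    fix x y
    have "\<bar>f x - f y\<bar> \<le> \<bar>L\<bar> * norm (x - y)"
      using assms[of x y] by (meson abs_ge_self mult_right_mono norm_ge_zero order_trans)
    then show "dist (f x) (f y) \<le> \<bar>L\<bar> * dist x y" by (simp add: dist_norm)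
  qed simp
  then show ?thesis by (rule lipschitz_on_continuous_on)
qed

text \<open>With \<open>q = (a - x) / \<delta>\<close>, moving \<open>v\<close> by
  \<open>s q\<close> moves \<open>x + \<delta> v\<close> the fraction \<open>s\<close> of the way to
  \<open>a + \<delta> v\<close>, so convexity bounds the increment of \<open>f\<close> by
  \<open>s\<close> times the full difference. This is integrated against a nonnegative kernel,
  divided by \<open>s\<close>, and \<open>s\<close> tends to 0. The left side
  \<open>J 1 - J c\<close> is an integral over the shell.\<close>

lemma convex_kernel_inequality:
  fixes f :: "'a::euclidean_space \<Rightarrow> real"
  assumes convex: "convex_on X f" and f: "continuous_on UNIV f"
    and "\<delta> > 0" "cball x \<delta> \<subseteq> X" "cball a \<delta> \<subseteq> X" and c: "0 < c" "c < 1"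
  defines "J \<equiv> \<lambda>c. \<integral>v. indicator (ball 0 c) v * (sgn v \<bullet> ((a - x) /\<^sub>R \<delta>)) * f (x + \<delta> *\<^sub>R v) \<partial>lborel"
  shows "J 1 - J c \<le> (\<integral>v. (cone_kernel 1 v - cone_kernel c v) * (f (a + \<delta> *\<^sub>R v) - f (x + \<delta> *\<^sub>R v)) \<partial>lborel)"
proof -
  define h where "h = (\<lambda>v. f (x + \<delta> *\<^sub>R v))"
  define q where "q = (a - x) /\<^sub>R \<delta>"
  have J: "J = (\<lambda>c. \<integral>v. indicator (ball 0 c) v * (sgn v \<bullet> q) * h v \<partial>lborel)"
    by (simp add: J_def h_def q_def)
  define P where "P = (\<lambda>v::'a. cone_kernel 1 v - cone_kernel c v)"
  have P0: "P v \<ge> 0" for v using c by (simp add: P_def cone_kernel_def)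
  have P1: "P v = 0" if "norm v \<ge> 1" for v using c that by (simp add: P_def cone_kernel_def)
  have h: "continuous_on UNIV h" unfolding h_def
    by (rule continuous_on_compose2[OF f]) (auto intro!: continuous_intros)
  have fa: "continuous_on UNIV (\<lambda>v. f (a + \<delta> *\<^sub>R v))"
    by (rule continuous_on_compose2[OF f]) (auto intro!: continuous_intros)
  have P: "continuous_on S P" for S unfolding P_def by (intro continuous_intros)
  have int_le: "(\<integral>v. real (Suc n) * (cone_kernel 1 (v - q /\<^sub>R real (Suc n)) - cone_kernel 1 v) * h v \<partial>lborel)
        - (\<integral>v. real (Suc n) * (cone_kernel c (v - q /\<^sub>R real (Suc n)) - cone_kernel c v) * h v \<partial>lborel)
      \<le> (\<integral>v. P v * (f (a + \<delta> *\<^sub>R v) - h v) \<partial>lborel)" for n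
  proof -
    define s where "s = 1 / real (Suc n)"
    have s: "0 < s" "s \<le> 1" "real (Suc n) = 1 / s" by (auto simp: s_def)
    have hs: "continuous_on UNIV (\<lambda>v. h (v + s *\<^sub>R q))"
      by (rule continuous_on_compose2[OF h]) (auto intro!: continuous_intros)
    have Ps: "continuous_on UNIV (\<lambda>v. P (v - s *\<^sub>R q))"
      by (rule continuous_on_compose2[OF P]) (auto intro!: continuous_intros)
    have far: "norm (v - s *\<^sub>R q) \<ge> 1" if "norm v > 1 + norm q" for v
    proof -
      have "norm (s *\<^sub>R q) \<le> norm q" using s by (simp add: mult_left_le_one_le)
      then show ?thesis using norm_triangle_ineq2[of v "s *\<^sub>R q"] that by linarith
    qed
    have i1: "integrable lborel (\<lambda>v. P v * h v)"
      by (rule integrable_continuous_bounded_support[where R=1]) (auto intro!: continuous_intros P h simp: P1)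
    have i2: "integrable lborel (\<lambda>v. P (v - s *\<^sub>R q) * h v)"
      by (rule integrable_continuous_bounded_support[where R="1 + norm q"]) (auto intro!: continuous_intros Ps h simp: P1 far)
    have i3: "integrable lborel (\<lambda>v. P v * h (v + s *\<^sub>R q))"
      by (rule integrable_continuous_bounded_support[where R=1]) (auto intro!: continuous_intros P hs simp: P1)
    have i4: "integrable lborel (\<lambda>v. P v * (f (a + \<delta> *\<^sub>R v) - h v))"
      by (rule integrable_continuous_bounded_support[where R=1]) (auto intro!: continuous_intros P h fa simp: P1)
    have i5: "integrable lborel (\<lambda>v. real (Suc n) * (cone_kernel b (v - s *\<^sub>R q) - cone_kernel b v) * h v)" if "b \<le> 1" for b
    proof (rule integrable_continuous_bounded_support[where R="1 + norm q"])
      fix v :: 'a assume "norm v > 1 + norm q"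
      then show "real (Suc n) * (cone_kernel b (v - s *\<^sub>R q) - cone_kernel b v) * h v = 0"
        using far[of v] that norm_ge_zero[of q] unfolding cone_kernel_def
        by (subst (1 2) max_absorb1) (linarith+, simp)
    qed (intro continuous_intros h)
    have quotient: "(p * A - p * B) / s \<le> p * Y" if "p * (A - B) \<le> p * (s * Y)" for p A B Y :: real
      using that s(1) by (simp add: field_simps)
    have regroup: "real (Suc n) * (k - l) * z - real (Suc n) * (k' - l') * z = ((k - k') * z - (l - l') * z) / s"
      for k l k' l' z :: real
    proof -
      have "(1 / s) * (k - l) * z - (1 / s) * (k' - l') * z = ((k - k') * z - (l - l') * z) / s"
        by (simp add: left_diff_distrib right_diff_distrib diff_divide_distrib)
      then show ?thesis by (simp only: s(3))
    qed
    \<comment> \<open>Convexity is invoked only for \<open>norm v \<le> 1\<close>, where both points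
      lie in \<open>X\<close>; elsewhere the kernel vanishes.\<close>
    have pointwise: "(P v * h (v + s *\<^sub>R q) - P v * h v) / s \<le> P v * (f (a + \<delta> *\<^sub>R v) - h v)" for v
    proof (cases "norm v \<le> 1")
      case True
      then have "x + \<delta> *\<^sub>R v \<in> X" "a + \<delta> *\<^sub>R v \<in> X"
        using assms(3-5) by (auto simp: subset_iff dist_norm)
      then have "f ((1 - s) *\<^sub>R (x + \<delta> *\<^sub>R v) + s *\<^sub>R (a + \<delta> *\<^sub>R v)) \<le> (1 - s) * f (x + \<delta> *\<^sub>R v) + s * f (a + \<delta> *\<^sub>R v)"
        using convex_onD[OF convex] s by simp
      also have "(1 - s) *\<^sub>R (x + \<delta> *\<^sub>R v) + s *\<^sub>R (a + \<delta> *\<^sub>R v) = x + \<delta> *\<^sub>R (v + s *\<^sub>R q)"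
      proof -
        have a: "a = x + \<delta> *\<^sub>R q" using assms(3) by (simp add: q_def)
        show ?thesis unfolding a by (simp add: algebra_simps)
      qed
      finally have "h (v + s *\<^sub>R q) - h v \<le> s * (f (a + \<delta> *\<^sub>R v) - h v)"
        by (simp add: h_def left_diff_distrib right_diff_distrib)
      from mult_left_mono[OF this P0[of v]] show ?thesis by (rule quotient)
    qed (simp add: P1)
    have "(\<integral>v. real (Suc n) * (cone_kernel 1 (v - s *\<^sub>R q) - cone_kernel 1 v) * h v \<partial>lborel)
        - (\<integral>v. real (Suc n) * (cone_kernel c (v - s *\<^sub>R q) - cone_kernel c v) * h v \<partial>lborel)
        = (\<integral>v. (P (v - s *\<^sub>R q) * h v - P v * h v) / s \<partial>lborel)"
    proof -
      have "c \<le> 1" using c by simp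
      then show ?thesis unfolding P_def
        by (subst Bochner_Integration.integral_diff[OF i5 i5, symmetric]) (simp_all only: regroup order_refl)
    qed
    also have "\<dots> = ((\<integral>v. P (v - s *\<^sub>R q) * h v \<partial>lborel) - (\<integral>v. P v * h v \<partial>lborel)) / s"
      using i1 i2 by simp
    \<comment> \<open>Translation invariance of Lebesgue measure moves the shift from the kernel to
      the function, where convexity can act.\<close>
    also have "(\<integral>v. P (v - s *\<^sub>R q) * h v \<partial>lborel) = (\<integral>v. P v * h (v + s *\<^sub>R q) \<partial>lborel)"
    proof -
      have "(\<lambda>v. P (v - s *\<^sub>R q) * h v) \<in> borel_measurable borel"
        using i2 by (simp add: borel_measurable_integrable)
      from lborel_integral_translate[OF this, of "s *\<^sub>R q"] show ?thesis by simp
    qed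
    also have "((\<integral>v. P v * h (v + s *\<^sub>R q) \<partial>lborel) - (\<integral>v. P v * h v \<partial>lborel)) / s
        = (\<integral>v. (P v * h (v + s *\<^sub>R q) - P v * h v) / s \<partial>lborel)"
      using i1 i3 by simp
    also have "\<dots> \<le> (\<integral>v. P v * (f (a + \<delta> *\<^sub>R v) - h v) \<partial>lborel)"
      using i1 i3 by (intro integral_mono i4 pointwise) auto
    finally show ?thesis by (simp add: s_def divide_inverse del: of_nat_Suc)
  qed
  have "J 1 - J c \<le> (\<integral>v. P v * (f (a + \<delta> *\<^sub>R v) - h v) \<partial>lborel)"
    unfolding J
    by (rule LIMSEQ_le_const2[OF tendsto_diff[OF cone_kernel_shift_integral[OF h] cone_kernel_shift_integral[OF h]]])
       (use c int_le in auto)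
  then show ?thesis by (simp add: P_def h_def)
qed

text \<open>The difference of the cones is the constant \<open>1 - c\<close> on the ball of radius
  \<open>c\<close>, falls to 0 across the shell and vanishes beyond. It thus lies between
  \<open>1 - c\<close> times the indicators of the two balls.\<close>

lemma cone_kernel_diff_integral:
  assumes c: "0 < c" "c < 1"
  shows "(1 - c) * c ^ DIM('a) * measure lborel (ball (0::'a::euclidean_space) 1)
      \<le> (\<integral>v. cone_kernel 1 v - cone_kernel c v \<partial>(lborel :: 'a measure))"
    and "(\<integral>v. cone_kernel 1 v - cone_kernel c v \<partial>(lborel :: 'a measure)) \<le> (1 - c) * measure lborel (ball (0::'a) 1)"
proof -
  have i: "integrable lborel (\<lambda>v::'a. cone_kernel 1 v - cone_kernel c v)"
    by (rule integrable_continuous_bounded_support[where R=1])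
      (use c in \<open>auto intro!: continuous_intros simp: cone_kernel_def\<close>)
  have b: "integrable lborel (\<lambda>v::'a. (1 - c) * indicator (ball 0 r) v)" for r
    using emeasure_bounded_finite[OF bounded_ball, of "0::'a" r]
    by (intro integrable_mult_right integrable_real_indicator) auto
  have "(1 - c) * (c ^ DIM('a) * measure lborel (ball (0::'a) 1)) = (\<integral>v. (1 - c) * indicator (ball (0::'a) c) v \<partial>lborel)"
    using measure_ball_scale[OF c(1), where 'a='a] by simp
  also have "\<dots> \<le> (\<integral>v. cone_kernel 1 v - cone_kernel c v \<partial>(lborel :: 'a measure))"
    by (rule integral_mono[OF b i]) (use c in \<open>auto simp: cone_kernel_def indicator_def\<close>)
  finally show "(1 - c) * c ^ DIM('a) * measure lborel (ball (0::'a::euclidean_space) 1)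
      \<le> (\<integral>v. cone_kernel 1 v - cone_kernel c v \<partial>(lborel :: 'a measure))" by simp
  have "(\<integral>v. cone_kernel 1 v - cone_kernel c v \<partial>(lborel :: 'a measure)) \<le> (\<integral>v. (1 - c) * indicator (ball (0::'a) 1) v \<partial>lborel)"
    by (rule integral_mono[OF i b]) (use c in \<open>auto simp: cone_kernel_def indicator_def\<close>)
  then show "(\<integral>v. cone_kernel 1 v - cone_kernel c v \<partial>(lborel :: 'a measure)) \<le> (1 - c) * measure lborel (ball (0::'a) 1)"
    by simp
qed

text \<open>On the shell \<open>v\<close> is within \<open>1 - c\<close> of \<open>sgn v\<close>, so
  replacing \<open>h v\<close> by \<open>h (sgn v)\<close> costs at most
  \<open>norm q * K * (1 - c)\<close>. The new integrand is homogeneous of degree 0, and scaling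
  both balls yields the factor \<open>1 - c ^ DIM('a)\<close>.\<close>

lemma shell_integral_lower_bound:
  fixes h :: "'a::euclidean_space \<Rightarrow> real" and q :: 'a
  assumes h: "\<And>v w. \<bar>h v - h w\<bar> \<le> K * norm (v - w)" and c: "0 < c" "c < 1"
  defines "G \<equiv> \<lambda>u. (u \<bullet> q) * h u"
    and "J \<equiv> \<lambda>c. \<integral>v. indicator (ball 0 c) v * (sgn v \<bullet> q) * h v \<partial>lborel"
  shows "(1 - c ^ DIM('a)) * ((\<integral>v. indicator (ball 0 1) v * G (sgn v) \<partial>lborel)
        - norm q * K * (1 - c) * measure lborel (ball (0::'a) 1)) \<le> J 1 - J c"
proof -
  have hc: "continuous_on S h" for S using h by (rule lipschitz_imp_continuous_on)
  have [measurable]: "h \<in> borel_measurable borel" by (rule borel_measurable_continuous_onI[OF hc])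
  have [measurable]: "G \<in> borel_measurable borel" unfolding G_def by measurable
  obtain B where B: "\<And>v. v \<in> cball 0 1 \<Longrightarrow> \<bar>h v\<bar> \<le> B"
    using compact_imp_bounded[OF compact_continuous_image[OF hc compact_cball], of 0 1]
    by (metis bounded_real image_eqI)
  have K0: "K \<ge> 0"
  proof -
    obtain e :: 'a where "e \<in> Basis" using nonempty_Basis by blast
    then show ?thesis using h[of e 0] by (simp add: order_trans[OF abs_ge_zero])
  qed
  have bnd: "integrable lborel (\<lambda>v::'a. indicator (ball 0 b) v * g v)"
    if [measurable]: "g \<in> borel_measurable borel" and "\<And>v. v \<in> ball 0 b \<Longrightarrow> \<bar>g v\<bar> \<le> M" for g :: "'a \<Rightarrow> real" and b M
  proof (rule Bochner_Integration.integrable_bound)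
    show "integrable lborel (\<lambda>v::'a. M * indicator (ball 0 b) v)"
      using emeasure_bounded_finite[OF bounded_ball, of "0::'a" b]
      by (intro integrable_mult_right integrable_real_indicator) auto
    show "AE v in lborel. norm (indicator (ball 0 b) v * g v) \<le> norm (M * indicator (ball 0 b) v)"
      by (rule AE_I2) (use that(2) in \<open>auto simp: indicator_def abs_le_iff abs_ge_self intro: order_trans[OF _ abs_ge_self]\<close>)
  qed measurable
  have cs: "\<bar>sgn v \<bullet> q\<bar> \<le> norm q" for v
    using Cauchy_Schwarz_ineq2[of "sgn v" q] by (auto simp: norm_sgn split: if_splits)
  have iG: "integrable lborel (\<lambda>v. indicator (ball 0 b) v * G (sgn v))" for b
  proof (rule bnd)
    fix v
    have "\<bar>h (sgn v)\<bar> \<le> B" by (rule B) (simp add: norm_sgn)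
    then show "\<bar>G (sgn v)\<bar> \<le> norm q * B" unfolding G_def abs_mult using cs by (intro mult_mono) auto
  qed measurable
  have iH: "integrable lborel (\<lambda>v. indicator (ball 0 b) v * ((sgn v \<bullet> q) * h v))" if "b \<le> 1" for b
  proof (rule bnd)
    fix v :: 'a assume "v \<in> ball 0 b"
    then have "\<bar>h v\<bar> \<le> B" using that by (intro B) simp
    then show "\<bar>(sgn v \<bullet> q) * h v\<bar> \<le> norm q * B" unfolding abs_mult using cs by (intro mult_mono) auto
  qed measurable
  define \<kappa> where "\<kappa> = norm q * K * (1 - c)"
  have i1: "integrable lborel (\<lambda>v. indicator (ball (0::'a) b) v * \<kappa>)" for b by (rule bnd) auto
  have one: "(\<integral>v. indicator (ball 0 b) v * (G (sgn v) - \<kappa>) \<partial>lborel)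
      = b ^ DIM('a) * ((\<integral>v. indicator (ball 0 1) v * G (sgn v) \<partial>lborel) - \<kappa> * measure lborel (ball (0::'a) 1))"
    if "b > 0" for b
  proof -
    have "(\<integral>v. indicator (ball 0 b) v * (G (sgn v) - \<kappa>) \<partial>lborel)
      = (\<integral>v. indicator (ball 0 b) v * G (sgn v) \<partial>lborel) - (\<integral>v. indicator (ball (0::'a) b) v * \<kappa> \<partial>lborel)"
      using iG i1 by (simp add: right_diff_distrib)
    then show ?thesis
      using integral_ball_sgn_scale[OF that, of G] measure_ball_scale[OF that, where 'a='a]
      by (simp add: algebra_simps)
  qed
  have iGk: "integrable lborel (\<lambda>v. indicator (ball 0 b) v * (G (sgn v) - \<kappa>))" for b
    using iG i1 by (simp add: right_diff_distrib)
  have "(1 - c ^ DIM('a)) * ((\<integral>v. indicator (ball 0 1) v * G (sgn v) \<partial>lborel) - \<kappa> * measure lborel (ball (0::'a) 1))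
      = (\<integral>v. indicator (ball 0 1) v * (G (sgn v) - \<kappa>) \<partial>lborel) - (\<integral>v. indicator (ball 0 c) v * (G (sgn v) - \<kappa>) \<partial>lborel)"
    using one[of 1] one[OF c(1)] by (simp add: left_diff_distrib)
  also have "\<dots> = (\<integral>v. indicator (ball 0 1) v * (G (sgn v) - \<kappa>) - indicator (ball 0 c) v * (G (sgn v) - \<kappa>) \<partial>lborel)"
    using iGk by simp
  also have "\<dots> \<le> (\<integral>v. indicator (ball 0 1) v * ((sgn v \<bullet> q) * h v) - indicator (ball 0 c) v * ((sgn v \<bullet> q) * h v) \<partial>lborel)"
  proof (intro integral_mono Bochner_Integration.integrable_diff iGk iH)
    fix v :: 'a
    show "indicator (ball 0 1) v * (G (sgn v) - \<kappa>) - indicator (ball 0 c) v * (G (sgn v) - \<kappa>)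
        \<le> indicator (ball 0 1) v * ((sgn v \<bullet> q) * h v) - indicator (ball 0 c) v * ((sgn v \<bullet> q) * h v)"
    \<comment> \<open>Off the shell the two indicators agree and both sides are 0.\<close>
    proof (cases "c \<le> norm v \<and> norm v < 1")
      case True
      then have "v \<noteq> 0" using c by auto
      have "norm v *\<^sub>R sgn v = v" using \<open>v \<noteq> 0\<close> by (simp add: sgn_div_norm)
      then have "sgn v - v = (1 - norm v) *\<^sub>R sgn v" by (simp add: scaleR_diff_left)
      then have "norm (sgn v - v) = 1 - norm v" using True \<open>v \<noteq> 0\<close> by (simp add: norm_sgn)
      then have "\<bar>h (sgn v) - h v\<bar> \<le> K * (1 - c)"
        using h[of "sgn v" v] mult_left_mono[of "1 - norm v" "1 - c" K] True K0 by simp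
      then have "\<bar>sgn v \<bullet> q\<bar> * \<bar>h (sgn v) - h v\<bar> \<le> norm q * (K * (1 - c))"
        using cs by (intro mult_mono) auto
      then have "(sgn v \<bullet> q) * (h (sgn v) - h v) \<le> \<kappa>"
        unfolding \<kappa>_def abs_mult[symmetric] mult.assoc by (rule order_trans[OF abs_ge_self])
      then have "G (sgn v) - (sgn v \<bullet> q) * h v \<le> \<kappa>"
        by (simp add: G_def right_diff_distrib)
      then show ?thesis using True by simp
    qed (use c in \<open>auto simp: indicator_def\<close>)
  qed (use c in auto)
  also have "\<dots> = J 1 - J c"
    unfolding J_def using iH[of 1] iH[of c] c by (simp add: mult.assoc)
  finally show ?thesis by (simp add: \<kappa>_def)
qed

text \<open>The shell of thickness \<open>e\<close> carries the fraction
  \<open>1 - (1 - e) ^ n\<close> of the ball, while the kernel has height \<open>e\<close>. Their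
  ratio is the source of the factor \<open>d\<close> in the gradient estimate.\<close>

lemma one_minus_power_quotient_tendsto:
  "((\<lambda>e::real. (1 - (1 - e) ^ n) / e) \<longlongrightarrow> real n) (at_right 0)"
proof -
  have "((\<lambda>e::real. - ((1 - e) ^ n)) has_real_derivative real n) (at 0)"
    by (auto intro!: derivative_eq_intros)
  then have "((\<lambda>e::real. (1 - (1 - e) ^ n) / e) \<longlongrightarrow> real n) (at 0)"
    by (simp add: has_field_derivative_iff)
  then show ?thesis by (rule tendsto_mono[OF at_le[OF subset_UNIV]])
qed

text \<open>The shell bound and the kernel inequality are combined at \<open>c = 1 - e\<close>, and
  \<open>e\<close> tends to 0. The error \<open>2 * L * \<delta>\<close> arises from replacing
  \<open>f (a + \<delta> v)\<close> and \<open>f (x + \<delta> v)\<close> by their values at the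
  centres, each at cost \<open>L * \<delta>\<close>.\<close>

lemma one_point_gradient_estimate:
  fixes f :: "real^'d \<Rightarrow> real"
  assumes convex: "convex_on X f" and lip: "\<And>y z. \<bar>f y - f z\<bar> \<le> L * norm (y - z)"
    and \<delta>: "\<delta> > 0" "cball x \<delta> \<subseteq> X" "cball a \<delta> \<subseteq> X"
  shows "real CARD('d) / \<delta> * (\<integral>u. f (x + \<delta> *\<^sub>R u) * (u \<bullet> (a - x)) \<partial>sphere_uniform) \<le> f a - f x + 2 * L * \<delta>"
proof -
  let ?V = "measure lborel (ball (0::real^'d) 1)"
  note V = measure_unit_ball_pos[where 'a="real^'d"]
  define q where "q = (a - x) /\<^sub>R \<delta>"
  define h where "h = (\<lambda>v. f (x + \<delta> *\<^sub>R v))"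
  define E where "E = (\<integral>u. (u \<bullet> q) * h u \<partial>sphere_uniform)"
  define \<kappa> where "\<kappa> = f a - f x + 2 * L * \<delta>"
  have f: "continuous_on S f" for S using lip by (rule lipschitz_imp_continuous_on)
  have h: "\<bar>h v - h w\<bar> \<le> (L * \<delta>) * norm (v - w)" for v w
    using lip[of "x + \<delta> *\<^sub>R v" "x + \<delta> *\<^sub>R w"] \<delta>(1)
    by (simp add: h_def scaleR_diff_right[symmetric] mult.assoc)
  have [measurable]: "h \<in> borel_measurable borel"
    by (rule borel_measurable_continuous_onI[OF lipschitz_imp_continuous_on[OF h]])
  have EV: "(\<integral>v. indicator (ball 0 1) v * ((sgn v \<bullet> q) * h (sgn v)) \<partial>lborel) = ?V * E"
    unfolding E_def using V by (subst sphere_uniform_integral) auto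
  define S where "S = (\<lambda>e::real. (1 - (1 - e) ^ CARD('d)) / e)"
  \<comment> \<open>Both sides are divided by \<open>e * ?V\<close>, the leading order of the mass
    of the kernel; the two error terms keep a factor \<open>e\<close> and vanish in the
    limit.\<close>
  have main: "S e * (E - norm q * (L * \<delta>) * e) \<le> \<kappa> + \<bar>\<kappa>\<bar> * S e * e" if e: "0 < e" "e < 1" for e
  proof -
    let ?P = "\<lambda>v::real^'d. cone_kernel 1 v - cone_kernel (1 - e) v"
    have c: "0 < 1 - e" "1 - e < 1" using e by auto
    have P0: "?P v \<ge> 0" for v using c by (simp add: cone_kernel_def)
    have P1: "?P v = 0" if "norm v \<ge> 1" for v using c that by (simp add: cone_kernel_def)
    have iP: "integrable lborel ?P"
      by (rule integrable_continuous_bounded_support[where R=1]) (auto intro!: continuous_intros simp: P1)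
    have bP: "(1 - e) ^ CARD('d) * (e * ?V) \<le> integral\<^sup>L lborel ?P" "integral\<^sup>L lborel ?P \<le> e * ?V"
      using cone_kernel_diff_integral[OF c, where 'a="real^'d"] by (simp_all add: mult_ac)
    have "(1 - (1 - e) ^ CARD('d)) * (?V * E - norm q * (L * \<delta>) * e * ?V)
        \<le> (\<integral>v. ?P v * (f (a + \<delta> *\<^sub>R v) - f (x + \<delta> *\<^sub>R v)) \<partial>lborel)"
    proof -
      have "(1 - (1 - e) ^ CARD('d)) * (?V * E - norm q * (L * \<delta>) * e * ?V)
        \<le> (\<integral>v. indicator (ball 0 1) v * (sgn v \<bullet> q) * h v \<partial>lborel)
          - (\<integral>v. indicator (ball 0 (1 - e)) v * (sgn v \<bullet> q) * h v \<partial>lborel)"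
        using shell_integral_lower_bound[OF h c, of q] by (simp add: EV)
      then show ?thesis
        using convex_kernel_inequality[OF convex f \<delta> c, folded q_def] unfolding h_def by linarith
    qed
    also have "\<dots> \<le> (\<integral>v. ?P v * \<kappa> \<partial>lborel)"
    proof (rule integral_mono)
      show "integrable lborel (\<lambda>v. ?P v * (f (a + \<delta> *\<^sub>R v) - f (x + \<delta> *\<^sub>R v)))"
        by (rule integrable_continuous_bounded_support[where R=1])
          (auto intro!: continuous_intros continuous_on_compose2[OF f[of UNIV]] simp: P1)
      fix v :: "real^'d"
      show "?P v * (f (a + \<delta> *\<^sub>R v) - f (x + \<delta> *\<^sub>R v)) \<le> ?P v * \<kappa>"
      proof (cases "norm v < 1")
        case True
        have L: "L \<ge> 0" using lip[of "axis undefined 1" 0] by (simp add: order_trans[OF abs_ge_zero])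
        have "\<bar>f (b + \<delta> *\<^sub>R v) - f b\<bar> \<le> L * \<delta>" for b
        proof -
          have "\<bar>f (b + \<delta> *\<^sub>R v) - f b\<bar> \<le> L * (\<delta> * norm v)"
            using lip[of "b + \<delta> *\<^sub>R v" b] \<delta>(1) by simp
          also have "\<dots> \<le> L * \<delta>" using True \<delta>(1) L by (intro mult_left_mono) auto
          finally show ?thesis .
        qed
        from this[of a] this[of x] have "f (a + \<delta> *\<^sub>R v) - f (x + \<delta> *\<^sub>R v) \<le> \<kappa>"
          unfolding \<kappa>_def by linarith
        then show ?thesis using P0 by (rule mult_left_mono)
      next
        case False
        then show ?thesis using P1[of v] by simp
      qed
    qed (use iP in auto)
    also have "\<dots> = integral\<^sup>L lborel ?P * \<kappa>" by simp
    \<comment> \<open>The sign of \<open>\<kappa>\<close> is unknown, so the mass missing from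
      \<open>e * ?V\<close> is charged with the absolute value of \<open>\<kappa>\<close>.\<close>
    also have "\<dots> \<le> e * ?V * \<kappa> + (e * ?V - integral\<^sup>L lborel ?P) * \<bar>\<kappa>\<bar>"
    proof -
      have "(e * ?V - integral\<^sup>L lborel ?P) * (- \<kappa>) \<le> (e * ?V - integral\<^sup>L lborel ?P) * \<bar>\<kappa>\<bar>"
        using bP(2) by (intro mult_left_mono) auto
      then show ?thesis by (simp add: algebra_simps)
    qed
    also have "\<dots> \<le> e * ?V * \<kappa> + (e * ?V - (1 - e) ^ CARD('d) * (e * ?V)) * \<bar>\<kappa>\<bar>"
      using bP(1) by (intro add_left_mono mult_right_mono) auto
    finally have "(e * ?V) * (S e * (E - norm q * (L * \<delta>) * e)) \<le> (e * ?V) * (\<kappa> + \<bar>\<kappa>\<bar> * S e * e)"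
    proof -
      have pow: "(1 - e) ^ CARD('d) = 1 - e * S e" using e by (simp add: S_def)
      assume "(1 - (1 - e) ^ CARD('d)) * (?V * E - norm q * (L * \<delta>) * e * ?V)
        \<le> e * ?V * \<kappa> + (e * ?V - (1 - e) ^ CARD('d) * (e * ?V)) * \<bar>\<kappa>\<bar>"
      then show ?thesis unfolding pow by (simp add: algebra_simps)
    qed
    then show ?thesis using e V by (simp add: mult_le_cancel_left_pos)
  qed
  have S: "(S \<longlongrightarrow> real CARD('d)) (at_right 0)"
    unfolding S_def by (rule one_minus_power_quotient_tendsto)
  have ev: "eventually (\<lambda>e::real. S e * (E - norm q * (L * \<delta>) * e) \<le> \<kappa> + \<bar>\<kappa>\<bar> * S e * e) (at_right 0)"
    using eventually_at_right_real[OF zero_less_one] by eventually_elim (use main in auto)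
  have lower: "((\<lambda>e. S e * (E - norm q * (L * \<delta>) * e)) \<longlongrightarrow> real CARD('d) * (E - norm q * (L * \<delta>) * 0)) (at_right 0)"
    by (intro tendsto_intros S)
  have upper: "((\<lambda>e. \<kappa> + \<bar>\<kappa>\<bar> * S e * e) \<longlongrightarrow> \<kappa> + \<bar>\<kappa>\<bar> * real CARD('d) * 0) (at_right 0)"
    by (intro tendsto_intros S)
  have "real CARD('d) * (E - norm q * (L * \<delta>) * 0) \<le> \<kappa> + \<bar>\<kappa>\<bar> * real CARD('d) * 0"
    by (rule tendsto_le[OF _ upper lower ev]) simp
  moreover have "E = (\<integral>u. f (x + \<delta> *\<^sub>R u) * (u \<bullet> (a - x)) \<partial>sphere_uniform) / \<delta>"
    unfolding E_def h_def q_def by (simp add: inner_scaleR_right divide_inverse mult_ac)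
  ultimately show ?thesis by (simp add: \<kappa>_def)
qed

subsection \<open>Projected gradient descent\<close>

text \<open>Summation by parts with nondecreasing weights; \<open>p\<close> will be the inverse of
  twice the step size. The induction carries the stronger bound
  \<open>p n * (B - W (Suc n))\<close>, whose slack pays for the growth from \<open>p n\<close> to
  \<open>p (Suc n)\<close>.\<close>

lemma weighted_telescope_bound:
  fixes p W :: "nat \<Rightarrow> real"
  assumes p: "\<And>t. t \<ge> 1 \<Longrightarrow> 0 \<le> p t" "\<And>t. t \<ge> 1 \<Longrightarrow> p t \<le> p (Suc t)"
    and W: "\<And>t. t \<ge> 1 \<Longrightarrow> t \<le> Suc T \<Longrightarrow> 0 \<le> W t" "\<And>t. t \<ge> 1 \<Longrightarrow> t \<le> Suc T \<Longrightarrow> W t \<le> B"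
    and "T \<ge> 1"
  shows "(\<Sum>t=1..T. p t * (W t - W (Suc t))) \<le> p T * B"
proof -
  have "(\<Sum>t=1..n. p t * (W t - W (Suc t))) \<le> p n * (B - W (Suc n))" if "n \<ge> 1" "n \<le> T" for n
    using that
  proof (induction n rule: dec_induct)
    case base
    then show ?case using p(1)[of 1] W(2)[of 1] by (simp add: mult_left_mono)
  next
    case (step n)
    have "(\<Sum>t=1..n. p t * (W t - W (Suc t))) \<le> p (Suc n) * (B - W (Suc n))"
      using step p(2)[of n] W(2)[of "Suc n"] by (intro order_trans[OF step.IH] mult_right_mono) auto
    then show ?case by (simp add: algebra_simps)
  qed
  from this[of T] have "(\<Sum>t=1..T. p t * (W t - W (Suc t))) \<le> p T * (B - W (Suc T))" using \<open>T \<ge> 1\<close> by simp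
  also have "\<dots> \<le> p T * B" using p(1)[of T] W(1)[of "Suc T"] \<open>T \<ge> 1\<close> by (intro mult_left_mono) auto
  finally show ?thesis .
qed

text \<open>Comparison with the integral of the power, by the mean value theorem on each interval
  from \<open>n\<close> to \<open>n + 1\<close>. Starting at 1 keeps the differentiation away from
  0.\<close>

lemma sum_powr_le:
  assumes b: "0 < b" "b \<le> 1" and "T \<ge> 1"
  shows "(\<Sum>t=1..T. real t powr (b - 1)) \<le> real T powr b / b"
  using \<open>T \<ge> 1\<close>
proof (induction T rule: dec_induct)
  case base
  then show ?case using b by simp
next
  case (step n)
  have "\<exists>z>real n. z < real (Suc n) \<and> real (Suc n) powr b - real n powr b = (real (Suc n) - real n) * (b * z powr (b - 1))"
    by (rule MVT2) (use step in \<open>auto intro!: derivative_eq_intros simp: powr_diff\<close>)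
  then obtain z where z: "real n < z" "z < real (Suc n)"
    "real (Suc n) powr b - real n powr b = b * z powr (b - 1)" by auto
  have "real (Suc n) powr (b - 1) \<le> z powr (b - 1)"
    using z b step by (intro powr_mono2') auto
  then have "b * real (Suc n) powr (b - 1) \<le> real (Suc n) powr b - real n powr b"
    unfolding z(3) using b by (intro mult_left_mono) auto
  then have "real (Suc n) powr (b - 1) \<le> (real (Suc n) powr b - real n powr b) / b"
    using b by (simp add: pos_le_divide_eq mult.commute)
  then show ?case using step by (simp add: diff_divide_distrib)
qed

text \<open>Projection is nonexpansive and fixes \<open>a\<close>; the rest is the expanded square
  of the unprojected step.\<close>

lemma projected_gradient_step:
  fixes S :: "'a::euclidean_space set"
  assumes S: "closed S" "convex S" "a \<in> S" and "\<eta> > 0"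
  shows "g \<bullet> (x - a) \<le> ((norm (x - a))\<^sup>2 - (norm (closest_point S (x - \<eta> *\<^sub>R g) - a))\<^sup>2) / (2 * \<eta>) + \<eta> / 2 * (norm g)\<^sup>2"
proof -
  have "norm (closest_point S (x - \<eta> *\<^sub>R g) - a) \<le> norm (x - \<eta> *\<^sub>R g - a)"
    using closest_point_lipschitz[of S "x - \<eta> *\<^sub>R g" a] S closest_point_self[of a S] by (auto simp: dist_norm)
  then have "(norm (closest_point S (x - \<eta> *\<^sub>R g) - a))\<^sup>2 \<le> (norm (x - \<eta> *\<^sub>R g - a))\<^sup>2"
    by (rule power_mono) simp
  also have "\<dots> = (norm (x - a))\<^sup>2 - 2 * \<eta> * (g \<bullet> (x - a)) + \<eta>\<^sup>2 * (norm g)\<^sup>2"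
  proof -
    have "x - \<eta> *\<^sub>R g - a = (x - a) - \<eta> *\<^sub>R g" by simp
    then show ?thesis
      by (simp only: power2_norm_eq_inner inner_diff_left inner_diff_right inner_scaleR_left inner_scaleR_right)
        (simp add: algebra_simps inner_commute power2_eq_square)
  qed
  finally have "2 * \<eta> * (g \<bullet> (x - a)) \<le> (norm (x - a))\<^sup>2 - (norm (closest_point S (x - \<eta> *\<^sub>R g) - a))\<^sup>2 + \<eta>\<^sup>2 * (norm g)\<^sup>2"
    by simp
  then have "g \<bullet> (x - a) \<le> ((norm (x - a))\<^sup>2 - (norm (closest_point S (x - \<eta> *\<^sub>R g) - a))\<^sup>2 + \<eta>\<^sup>2 * (norm g)\<^sup>2) / (2 * \<eta>)"
    using \<open>\<eta> > 0\<close> by (simp add: pos_le_divide_eq mult.commute)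
  also have "\<dots> = ((norm (x - a))\<^sup>2 - (norm (closest_point S (x - \<eta> *\<^sub>R g) - a))\<^sup>2) / (2 * \<eta>) + \<eta> / 2 * (norm g)\<^sup>2"
    using \<open>\<eta> > 0\<close> by (simp add: add_divide_distrib power2_eq_square)
  finally show ?thesis .
qed

section \<open>Gradients relative to a convex set\<close>

lemma gradient_within_has_derivative:
  fixes S :: "(real^'d) set"
  assumes "convex S" "interior S \<noteq> {}" "a \<in> S" "f differentiable (at a within S)"
  shows "(f has_derivative (\<lambda>h. h \<bullet> gradient_within f a S)) (at a within S)"
proof -
  obtain F where F: "(f has_derivative F) (at a within S)" using assms(4) unfolding differentiable_def by blast
  then have lin: "linear F" by (rule has_derivative_linear)
  define g where "g = (\<Sum>b\<in>Basis. F b *\<^sub>R b)"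
  have "F h = h \<bullet> g" for h
  proof -
    have "F h = F (\<Sum>b\<in>Basis. (h \<bullet> b) *\<^sub>R b)" by (simp add: euclidean_representation)
    also have "\<dots> = (\<Sum>b\<in>Basis. (h \<bullet> b) * F b)" by (simp add: linear_sum[OF lin] linear_scale[OF lin])
    also have "\<dots> = h \<bullet> g" by (simp add: g_def inner_sum_right mult.commute)
    finally show ?thesis .
  qed
  then have "F = (\<lambda>h. h \<bullet> g)" by auto
  with F have g: "(f has_derivative (\<lambda>h. h \<bullet> g)) (at a within S)" by simp
  with gradient_within_eq[OF assms(1-3) g] show ?thesis by simp
qed

text \<open>Segments from \<open>a\<close> to points of \<open>S\<close> stay in \<open>S\<close>,
  so these quotients see only admissible values. They give the first-order convexity inequality, the
  norm bound and the measurability of the gradient.\<close>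

lemma gradient_within_difference_quotient:
  fixes S :: "(real^'d) set"
  assumes S: "convex S" "interior S \<noteq> {}" "a \<in> S" "f differentiable (at a within S)" and "b \<in> S"
  shows "(\<lambda>n. real (Suc n) * (f (a + (b - a) /\<^sub>R real (Suc n)) - f a)) \<longlonglongrightarrow> (b - a) \<bullet> gradient_within f a S"
proof -
  let ?g = "gradient_within f a S"
  have path: "((\<lambda>t. a + t *\<^sub>R (b - a)) has_derivative (\<lambda>t. t *\<^sub>R (b - a))) (at 0 within {0..1})"
    by (auto intro!: derivative_eq_intros)
  have "(\<lambda>t. a + t *\<^sub>R (b - a)) ` {0..1} \<subseteq> S"
  proof clarify
    fix t :: real assume "t \<in> {0..1}"
    then have "(1 - t) *\<^sub>R a + t *\<^sub>R b \<in> S"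
      using convexD[OF \<open>convex S\<close> \<open>a \<in> S\<close> \<open>b \<in> S\<close>, of "1 - t" t] by auto
    then show "a + t *\<^sub>R (b - a) \<in> S" by (simp add: algebra_simps)
  qed
  then have "((\<lambda>t. f (a + t *\<^sub>R (b - a))) has_derivative (\<lambda>t. (t *\<^sub>R (b - a)) \<bullet> ?g)) (at 0 within {0..1})"
    using has_derivative_in_compose[OF path, of f "\<lambda>h. h \<bullet> ?g"]
      has_derivative_subset[OF gradient_within_has_derivative[OF S]] by simp
  then have "((\<lambda>t. f (a + t *\<^sub>R (b - a))) has_real_derivative (b - a) \<bullet> ?g) (at 0 within {0..1})"
    by (simp add: has_field_derivative_def mult_commute_abs)
  then have lim: "((\<lambda>t. (f (a + t *\<^sub>R (b - a)) - f a) / t) \<longlongrightarrow> (b - a) \<bullet> ?g) (at 0 within {0..1})"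
    by (simp add: has_field_derivative_iff)
  have "filterlim (\<lambda>n. inverse (real (Suc n))) (at 0 within {0..1}) sequentially"
    unfolding filterlim_at using LIMSEQ_inverse_real_of_nat by (auto simp: inverse_le_1_iff)
  from filterlim_compose[OF lim this] show ?thesis
    by (simp add: divide_inverse mult.commute)
qed

lemma segment_point_in:
  assumes "convex S" "a \<in> S" "b \<in> S"
  shows "a + (b - a) /\<^sub>R real (Suc n) \<in> S"
proof -
  have "(1 - inverse (real (Suc n))) *\<^sub>R a + inverse (real (Suc n)) *\<^sub>R b \<in> S"
    by (rule convexD[OF assms]) (auto simp: inverse_le_1_iff)
  then show ?thesis by (simp add: algebra_simps del: of_nat_Suc)
qed

lemma convex_gradient_within_le:
  fixes S :: "(real^'d) set"
  assumes S: "convex S" "interior S \<noteq> {}" "a \<in> S" "f differentiable (at a within S)" and "b \<in> S"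
    and f: "convex_on S f"
  shows "f a - f b \<le> gradient_within f a S \<bullet> (a - b)"
proof -
  have "(b - a) \<bullet> gradient_within f a S \<le> f b - f a"
  proof (rule LIMSEQ_le_const2[OF gradient_within_difference_quotient[OF S \<open>b \<in> S\<close>]])
    have "real (Suc n) * (f (a + (b - a) /\<^sub>R real (Suc n)) - f a) \<le> f b - f a" for n
    proof -
      define s where "s = inverse (real (Suc n))"
      have s: "0 < s" "s \<le> 1" by (auto simp: s_def inverse_le_1_iff)
      have "f ((1 - s) *\<^sub>R a + s *\<^sub>R b) \<le> (1 - s) * f a + s * f b"
        using convex_onD[OF f _ _ \<open>a \<in> S\<close> \<open>b \<in> S\<close>] s by simp
      also have "(1 - s) *\<^sub>R a + s *\<^sub>R b = a + s *\<^sub>R (b - a)" by (simp add: algebra_simps)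
      finally have "f (a + s *\<^sub>R (b - a)) - f a \<le> s * (f b - f a)" by (simp add: algebra_simps)
      then have "f (a + (b - a) /\<^sub>R real (Suc n)) - f a \<le> (f b - f a) / real (Suc n)"
        by (simp add: s_def divide_inverse mult.commute del: of_nat_Suc)
      then show ?thesis by (simp add: pos_le_divide_eq mult.commute del: of_nat_Suc)
    qed
    then show "\<exists>N. \<forall>n\<ge>N. real (Suc n) * (f (a + (b - a) /\<^sub>R real (Suc n)) - f a) \<le> f b - f a" by blast
  qed
  then show ?thesis by (simp add: inner_diff_left inner_diff_right inner_commute)
qed

text \<open>At a boundary point the segment in the direction of the gradient may leave
  \<open>S\<close>. Two segments that stay in \<open>S\<close> are compared instead, one towards
  \<open>b = r * sgn g\<close> and one towards 0: at step \<open>1 / (n + 1)\<close> their points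
  differ by \<open>b / (n + 1)\<close>, and the linear parts by
  \<open>b \<bullet> g = r * norm g\<close>.\<close>

lemma gradient_within_norm_le:
  fixes S :: "(real^'d) set"
  assumes S: "convex S" "cball 0 r \<subseteq> S" "a \<in> S" "f differentiable (at a within S)" and "r > 0"
    and f: "\<And>b c. b \<in> S \<Longrightarrow> c \<in> S \<Longrightarrow> \<bar>f b - f c\<bar> \<le> L * norm (b - c)"
  shows "norm (gradient_within f a S) \<le> L"
proof -
  let ?g = "gradient_within f a S"
  have int: "interior S \<noteq> {}"
    using interior_mono[OF S(2)] \<open>r > 0\<close> by auto
  define b where "b = r *\<^sub>R sgn ?g"
  have "b \<in> S" "0 \<in> S" using S(2) \<open>r > 0\<close> by (auto simp: b_def norm_sgn subset_iff)
  have L: "L \<ge> 0"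
    using f[of "r *\<^sub>R axis undefined 1" 0] \<open>r > 0\<close> S(2) \<open>0 \<in> S\<close>
    by (auto simp: subset_iff zero_le_mult_iff dest!: order_trans[OF abs_ge_zero])
  have "(b - a) \<bullet> ?g - (0 - a) \<bullet> ?g \<le> L * norm b"
  proof (rule LIMSEQ_le_const2[OF tendsto_diff[OF
        gradient_within_difference_quotient[OF S(1) int S(3,4) \<open>b \<in> S\<close>]
        gradient_within_difference_quotient[OF S(1) int S(3,4) \<open>0 \<in> S\<close>]]])
    have "real (Suc n) * (f (a + (b - a) /\<^sub>R real (Suc n)) - f a) - real (Suc n) * (f (a + (0 - a) /\<^sub>R real (Suc n)) - f a)
        \<le> L * norm b" for n
    proof -
      let ?b = "a + (b - a) /\<^sub>R real (Suc n)" and ?c = "a + (0 - a) /\<^sub>R real (Suc n)"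
      have "\<bar>f ?b - f ?c\<bar> \<le> L * norm (?b - ?c)"
        using f segment_point_in[OF S(1,3) \<open>b \<in> S\<close>] segment_point_in[OF S(1,3) \<open>0 \<in> S\<close>] by blast
      also have "?b - ?c = b /\<^sub>R real (Suc n)" by (simp add: scaleR_diff_right)
      finally have "f ?b - f ?c \<le> L * norm b / real (Suc n)" by (simp add: divide_inverse mult_ac del: of_nat_Suc)
      then have "real (Suc n) * (f ?b - f ?c) \<le> L * norm b"
        by (simp add: pos_le_divide_eq mult.commute del: of_nat_Suc)
      then show ?thesis by (simp add: right_diff_distrib del: of_nat_Suc)
    qed
    then show "\<exists>N. \<forall>n\<ge>N. real (Suc n) * (f (a + (b - a) /\<^sub>R real (Suc n)) - f a)
        - real (Suc n) * (f (a + (0 - a) /\<^sub>R real (Suc n)) - f a) \<le> L * norm b" by blast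
  qed
  then have "b \<bullet> ?g \<le> L * norm b" by (simp add: inner_diff_left)
  moreover have "b \<bullet> ?g = r * norm ?g"
    by (cases "?g = 0") (simp_all add: b_def sgn_div_norm power2_norm_eq_inner[symmetric] power2_eq_square)
  moreover have "norm b \<le> r" using \<open>r > 0\<close> by (simp add: b_def norm_sgn)
  ultimately have "r * norm ?g \<le> r * L" using L mult_left_mono[of "norm b" r L] by (simp add: mult.commute)
  then show ?thesis using \<open>r > 0\<close> by simp
qed

subsection \<open>Shrunken action sets\<close>

lemma shrunk_closed:
  fixes S :: "(real^'d) set"
  assumes "closed S" shows "closed (shrunk r \<delta> S)"
proof -
  have "shrunk r \<delta> S = S \<inter> (\<lambda>a. (1 / (1 - \<delta> / r)) *\<^sub>R a) -` S" by (auto simp: shrunk_def)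
  moreover have "closed ((\<lambda>a. (1 / (1 - \<delta> / r)) *\<^sub>R a) -` S)"
    by (rule continuous_closed_vimage[OF assms]) (auto intro!: continuous_intros)
  ultimately show ?thesis using assms by (simp only: closed_Int)
qed

lemma shrunk_convex:
  fixes S :: "(real^'d) set"
  assumes "convex S" shows "convex (shrunk r \<delta> S)"
proof (rule convexI)
  fix x y u v assume *: "x \<in> shrunk r \<delta> S" "y \<in> shrunk r \<delta> S" "0 \<le> u" "0 \<le> v" "u + v = (1::real)"
  let ?c = "1 / (1 - \<delta> / r)"
  have "u *\<^sub>R (?c *\<^sub>R x) + v *\<^sub>R (?c *\<^sub>R y) \<in> S"
    by (rule convexD[OF assms]) (use * in \<open>auto simp: shrunk_def\<close>)
  moreover have "u *\<^sub>R (?c *\<^sub>R x) + v *\<^sub>R (?c *\<^sub>R y) = ?c *\<^sub>R (u *\<^sub>R x + v *\<^sub>R y)"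
    by (simp only: scaleR_add_right scaleR_left_commute)
  moreover have "u *\<^sub>R x + v *\<^sub>R y \<in> S" by (rule convexD[OF assms]) (use * in \<open>auto simp: shrunk_def\<close>)
  ultimately show "u *\<^sub>R x + v *\<^sub>R y \<in> shrunk r \<delta> S" by (simp add: shrunk_def)
qed

lemma scaleR_mem_convex_zero:
  fixes S :: "'a::real_vector set"
  assumes "convex S" "0 \<in> S" "a \<in> S" "0 \<le> c" "c \<le> 1"
  shows "c *\<^sub>R a \<in> S"
  using convexD[OF assms(1,2,3), of "1 - c" c] assms(4,5) by simp

lemma scaleR_mem_shrunk:
  fixes S :: "(real^'d) set"
  assumes "convex S" "0 \<in> S" "a \<in> S" "0 < \<delta>" "\<delta> < r"
  shows "(1 - \<delta> / r) *\<^sub>R a \<in> shrunk r \<delta> S"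
  using assms scaleR_mem_convex_zero[OF assms(1-3), of "1 - \<delta> / r"] by (simp add: shrunk_def)

text \<open>With \<open>p\<close> and \<open>q\<close> the two factors, \<open>a / q\<close> is
  \<open>a / p\<close> scaled towards the origin by \<open>p / q\<close>. The sets therefore grow as
  \<open>\<delta> t\<close> decreases.\<close>

lemma shrunk_mono:
  fixes S :: "(real^'d) set"
  assumes "convex S" "0 \<in> S" "0 < \<delta>'" "\<delta>' \<le> \<delta>" "\<delta> < r"
  shows "shrunk r \<delta> S \<subseteq> shrunk r \<delta>' S"
proof
  fix a assume a: "a \<in> shrunk r \<delta> S"
  define p where "p = 1 - \<delta> / r"
  define q where "q = 1 - \<delta>' / r"
  have pos: "0 < p" "p \<le> q" using assms by (auto simp: p_def q_def field_simps)
  have "(p / q) *\<^sub>R ((1 / p) *\<^sub>R a) \<in> S"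
  proof (rule scaleR_mem_convex_zero[OF assms(1,2)])
    show "(1 / p) *\<^sub>R a \<in> S" using a by (simp add: shrunk_def p_def)
  qed (use pos in auto)
  then show "a \<in> shrunk r \<delta>' S" using a pos by (simp add: shrunk_def q_def[symmetric])
qed

text \<open>A point \<open>b\<close> of the ball is the convex combination, with weights
  \<open>1 - \<delta> / r\<close> and \<open>\<delta> / r\<close>, of \<open>x\<close> divided by
  \<open>1 - \<delta> / r\<close> and of \<open>(r / \<delta>) (b - x)\<close>, which has norm at
  most \<open>r\<close>.\<close>

lemma cball_subset_of_shrunk:
  fixes S :: "(real^'d) set"
  assumes S: "convex S" "cball 0 r \<subseteq> S" and \<delta>: "0 < \<delta>" "\<delta> < r" and x: "x \<in> shrunk r \<delta> S"
  shows "cball x \<delta> \<subseteq> S"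
proof
  fix b assume b: "b \<in> cball x \<delta>"
  have pos: "0 < 1 - \<delta> / r" using \<delta> by simp
  have "(r / \<delta>) * norm (b - x) \<le> (r / \<delta>) * \<delta>"
    using b \<delta> by (intro mult_left_mono) (auto simp: dist_norm norm_minus_commute)
  then have "norm ((r / \<delta>) *\<^sub>R (b - x)) \<le> r" using \<delta> by simp
  then have "(r / \<delta>) *\<^sub>R (b - x) \<in> S" using S(2) by (auto simp: subset_iff)
  moreover have "(1 / (1 - \<delta> / r)) *\<^sub>R x \<in> S" using x by (simp add: shrunk_def)
  ultimately have "(1 - \<delta> / r) *\<^sub>R ((1 / (1 - \<delta> / r)) *\<^sub>R x) + (\<delta> / r) *\<^sub>R ((r / \<delta>) *\<^sub>R (b - x)) \<in> S"
    using \<delta> by (intro convexD[OF S(1)]) auto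
  then show "b \<in> S" using pos \<delta> by simp
qed

subsection \<open>Resampling one coordinate of a product measure\<close>

locale iid_product =
  fixes I :: "'i set" and S :: "'a measure"
  assumes prob_factor: "prob_space S"
begin

sublocale factor: prob_space S by (rule prob_factor)

abbreviation "P \<equiv> Pi\<^sub>M I (\<lambda>_. S)"

sublocale prob_space P by (intro prob_space_PiM prob_factor)

lemma fun_upd_space [simp]:
  assumes "k \<in> I" "u \<in> space P" "v \<in> space S"
  shows "u(k := v) \<in> space P"
  using assms by (auto simp: space_PiM PiE_def Pi_iff extensional_def)

lemma measurable_fun_upd_pair:
  assumes "k \<in> I"
  shows "(\<lambda>(v, u). u(k := v)) \<in> measurable (S \<Otimes>\<^sub>M P) P"
proof (rule measurable_PiM_single')
  show "(\<lambda>z. (case z of (v, u) \<Rightarrow> u(k := v)) i) \<in> measurable (S \<Otimes>\<^sub>M P) S" if "i \<in> I" for i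
  proof (cases "i = k")
    case False
    have "(\<lambda>z. snd z i) \<in> measurable (S \<Otimes>\<^sub>M P) S"
      using that by (intro measurable_compose[OF measurable_snd measurable_component_singleton])
    then show ?thesis using False by (simp add: case_prod_beta)
  qed (simp add: case_prod_beta)
  show "(\<lambda>z i. (case z of (v, u) \<Rightarrow> u(k := v)) i) \<in> space (S \<Otimes>\<^sub>M P) \<rightarrow> I \<rightarrow>\<^sub>E space S"
    using assms fun_upd_space[OF assms] by (auto simp: space_pair_measure space_PiM)
qed

lemma measurable_resample:
  assumes "k \<in> I" "F \<in> measurable P N"
  shows "(\<lambda>(u, v). F (u(k := v))) \<in> measurable (P \<Otimes>\<^sub>M S) N"
proof -
  have "(\<lambda>(u, v). u(k := v)) \<in> measurable (P \<Otimes>\<^sub>M S) P"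
    using measurable_compose[OF measurable_pair_swap' measurable_fun_upd_pair[OF assms(1)]] by (simp add: case_prod_beta)
  from measurable_compose[OF this assms(2)] show ?thesis by (simp add: case_prod_beta)
qed

text \<open>Overwriting coordinate \<open>k\<close> by an independent copy preserves the product
  law; Fubini then integrates the copy first.\<close>

lemma resample_integral:
  fixes F :: "('i \<Rightarrow> 'a) \<Rightarrow> 'b::{banach, second_countable_topology}"
  assumes k: "k \<in> I" and F: "integrable P F"
  shows "(\<integral>u. F u \<partial>P) = (\<integral>u. (\<integral>v. F (u(k := v)) \<partial>S) \<partial>P)"
proof -
  interpret PS: pair_sigma_finite P S ..
  interpret SP: pair_sigma_finite S P ..
  have eq: "distr (S \<Otimes>\<^sub>M P) P (\<lambda>(v, u). u(k := v)) = P"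
    using distr_pair_PiM_eq_PiM[of I "\<lambda>_. S" k] prob_factor k by (simp add: insert_absorb)
  have m: "F \<in> borel_measurable P" using F by simp
  have i: "integrable (S \<Otimes>\<^sub>M P) (\<lambda>z. F ((snd z)(k := fst z)))"
    using integrable_distr_eq[OF measurable_fun_upd_pair[OF k] m] F unfolding eq by (simp add: case_prod_beta)
  have i': "integrable (P \<Otimes>\<^sub>M S) (\<lambda>z. F ((fst z)(k := snd z)))"
    using SP.integrable_product_swap[OF i] by (simp only: split_def fst_conv snd_conv)
  have "(\<integral>u. F u \<partial>P) = (\<integral>z. F ((snd z)(k := fst z)) \<partial>(S \<Otimes>\<^sub>M P))"
    using integral_distr[OF measurable_fun_upd_pair[OF k] m] unfolding eq by (simp add: case_prod_beta)
  also have "\<dots> = (\<integral>z. F ((fst z)(k := snd z)) \<partial>(P \<Otimes>\<^sub>M S))"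
    using SP.integral_product_swap[OF borel_measurable_integrable[OF i]]
    unfolding split_def fst_conv snd_conv by (rule sym)
  also have "\<dots> = (\<integral>u. (\<integral>v. F (u(k := v)) \<partial>S) \<partial>P)"
    using PS.integral_fst'[OF i'] by (simp add: case_prod_beta)
  finally show ?thesis .
qed

text \<open>The inner integral is an everywhere defined version of the conditional expectation of
  \<open>G\<close> given all coordinates except \<open>k\<close>.\<close>

definition centered :: "'i \<Rightarrow> (('i \<Rightarrow> 'a) \<Rightarrow> 'b::euclidean_space) \<Rightarrow> ('i \<Rightarrow> 'a) \<Rightarrow> 'b" where
  "centered k G u = G u - (\<integral>v. G (u(k := v)) \<partial>S)"

lemma integrable_section:
  fixes G :: "('i \<Rightarrow> 'a) \<Rightarrow> 'b::euclidean_space"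
  assumes k: "k \<in> I" and G: "G \<in> borel_measurable P" "\<And>u. u \<in> space P \<Longrightarrow> norm (G u) \<le> B" and u: "u \<in> space P"
  shows "integrable S (\<lambda>v. G (u(k := v)))"
proof (rule factor.integrable_const_bound)
  show "AE v in S. norm (G (u(k := v))) \<le> B" using G(2) k u by (intro AE_I2) auto
  show "(\<lambda>v. G (u(k := v))) \<in> borel_measurable S"
    using measurable_compose[OF measurable_Pair1'[OF u] measurable_resample[OF k G(1)]] by simp
qed

lemma measurable_mean:
  fixes G :: "('i \<Rightarrow> 'a) \<Rightarrow> 'b::euclidean_space"
  assumes k: "k \<in> I" and G: "G \<in> borel_measurable P"
  shows "(\<lambda>u. \<integral>v. G (u(k := v)) \<partial>S) \<in> borel_measurable P"
  using factor.borel_measurable_lebesgue_integral[OF measurable_resample[OF k G]] by simp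

lemma measurable_centered:
  fixes G :: "('i \<Rightarrow> 'a) \<Rightarrow> 'b::euclidean_space"
  assumes "k \<in> I" "G \<in> borel_measurable P"
  shows "centered k G \<in> borel_measurable P"
  unfolding centered_def[abs_def] by (intro borel_measurable_diff assms measurable_mean)

lemma norm_centered_le:
  fixes G :: "('i \<Rightarrow> 'a) \<Rightarrow> 'b::euclidean_space"
  assumes k: "k \<in> I" and G: "G \<in> borel_measurable P" "\<And>u. u \<in> space P \<Longrightarrow> norm (G u) \<le> B" and u: "u \<in> space P"
  shows "norm (centered k G u) \<le> 2 * B"
proof -
  have "norm (\<integral>v. G (u(k := v)) \<partial>S) \<le> (\<integral>v. norm (G (u(k := v))) \<partial>S)" by simp
  also have "\<dots> \<le> (\<integral>v. B \<partial>S)"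
    using integrable_section[OF k G u] G(2) k u by (intro integral_mono) auto
  finally have "norm (\<integral>v. G (u(k := v)) \<partial>S) \<le> B" by (simp add: factor.prob_space)
  then show ?thesis
    unfolding centered_def using norm_triangle_ineq4[of "G u" "\<integral>v. G (u(k := v)) \<partial>S"] G(2)[OF u] by linarith
qed

text \<open>With the other coordinates fixed, \<open>H\<close> is constant in coordinate
  \<open>k\<close> and comes out of the inner integral, where the centred function has mean
  0.\<close>

lemma centered_orthogonal:
  fixes G H :: "('i \<Rightarrow> 'a) \<Rightarrow> 'b::euclidean_space"
  assumes k: "k \<in> I" and G: "G \<in> borel_measurable P" "\<And>u. u \<in> space P \<Longrightarrow> norm (G u) \<le> B"
    and H: "H \<in> borel_measurable P" "\<And>u. u \<in> space P \<Longrightarrow> norm (H u) \<le> B'"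
    and inv: "\<And>u v. u \<in> space P \<Longrightarrow> v \<in> space S \<Longrightarrow> H (u(k := v)) = H u"
  shows "integrable P (\<lambda>u. H u \<bullet> centered k G u)" "(\<integral>u. H u \<bullet> centered k G u \<partial>P) = 0"
proof -
  show int: "integrable P (\<lambda>u. H u \<bullet> centered k G u)"
  proof (rule integrable_const_bound)
    show "AE u in P. norm (H u \<bullet> centered k G u) \<le> B' * (2 * B)"
    proof (rule AE_I2)
      fix u assume u: "u \<in> space P"
      have "norm (H u \<bullet> centered k G u) \<le> norm (H u) * norm (centered k G u)"
        by (simp add: Cauchy_Schwarz_ineq2)
      also have "\<dots> \<le> B' * (2 * B)"
        using H(2)[OF u] norm_centered_le[OF k G u] by (intro mult_mono) (auto intro: order_trans[OF norm_ge_zero])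
      finally show "norm (H u \<bullet> centered k G u) \<le> B' * (2 * B)" .
    qed
  qed (intro borel_measurable_inner H(1) measurable_centered[OF k G(1)])
  have "(\<integral>v. H (u(k := v)) \<bullet> centered k G (u(k := v)) \<partial>S) = 0" if u: "u \<in> space P" for u
  proof -
    note i = integrable_section[OF k G u]
    \<comment> \<open>The subtracted mean is unchanged by the update: its own update of
      \<open>k\<close> overrides the earlier one.\<close>
    have "(\<integral>v. H (u(k := v)) \<bullet> centered k G (u(k := v)) \<partial>S)
        = (\<integral>v. H u \<bullet> (G (u(k := v)) - (\<integral>w. G (u(k := w)) \<partial>S)) \<partial>S)"
      using inv u by (intro Bochner_Integration.integral_cong) (auto simp: centered_def)
    also have "\<dots> = H u \<bullet> (\<integral>v. G (u(k := v)) - (\<integral>w. G (u(k := w)) \<partial>S) \<partial>S)"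
      using i by simp
    also have "\<dots> = 0" using i by (simp add: factor.prob_space)
    finally show ?thesis .
  qed
  then have "(\<integral>u. (\<integral>v. H (u(k := v)) \<bullet> centered k G (u(k := v)) \<partial>S) \<partial>P) = (\<integral>u. 0 \<partial>P)"
    by (intro Bochner_Integration.integral_cong) auto
  then show "(\<integral>u. H u \<bullet> centered k G u \<partial>P) = 0"
    using resample_integral[OF k int] by simp
qed

text \<open>Adding the last summand creates a cross term with the earlier partial sum. That sum does
  not depend on coordinate \<open>\<kappa> (Suc n)\<close>, so the cross term integrates to 0. The
  factor 4 is the square of the 2 in \<open>norm_centered_le\<close>.\<close>

lemma centered_sum_second_moment:
  fixes G :: "nat \<Rightarrow> ('i \<Rightarrow> 'a) \<Rightarrow> 'b::euclidean_space"
  assumes \<kappa>: "\<And>t. t \<in> {1..T} \<Longrightarrow> \<kappa> t \<in> I"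
    and G: "\<And>t. t \<in> {1..T} \<Longrightarrow> G t \<in> borel_measurable P"
      "\<And>t u. t \<in> {1..T} \<Longrightarrow> u \<in> space P \<Longrightarrow> norm (G t u) \<le> B t"
    and w: "\<And>t. t \<in> {1..T} \<Longrightarrow> \<bar>w t\<bar> \<le> 1"
    and adapted: "\<And>s t u v. s \<in> {1..T} \<Longrightarrow> t \<in> {1..T} \<Longrightarrow> s < t \<Longrightarrow> u \<in> space P \<Longrightarrow> v \<in> space S \<Longrightarrow>
      centered (\<kappa> s) (G s) (u(\<kappa> t := v)) = centered (\<kappa> s) (G s) u"
  shows "integrable P (\<lambda>u. (norm (\<Sum>t=1..T. w t *\<^sub>R centered (\<kappa> t) (G t) u))\<^sup>2)"
    and "(\<integral>u. (norm (\<Sum>t=1..T. w t *\<^sub>R centered (\<kappa> t) (G t) u))\<^sup>2 \<partial>P) \<le> (\<Sum>t=1..T. 4 * (B t)\<^sup>2)"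
proof -
  define \<xi> where "\<xi> = (\<lambda>t u. centered (\<kappa> t) (G t) u)"
  have \<xi>m: "\<xi> t \<in> borel_measurable P" if "t \<in> {1..T}" for t
    unfolding \<xi>_def using measurable_centered[OF \<kappa> G(1)] that by simp
  have \<xi>b: "norm (\<xi> t u) \<le> 2 * B t" if "t \<in> {1..T}" "u \<in> space P" for t u
    unfolding \<xi>_def using norm_centered_le[OF \<kappa> G] that by blast
  have wb: "norm (w t *\<^sub>R \<xi> t u) \<le> 2 * B t" if "t \<in> {1..T}" "u \<in> space P" for t u
    using w[OF that(1)] mult_right_mono[of "\<bar>w t\<bar>" 1 "norm (\<xi> t u)"] \<xi>b[OF that] by simp
  have "integrable P (\<lambda>u. (norm (\<Sum>t=1..n. w t *\<^sub>R \<xi> t u))\<^sup>2) \<and>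
      (\<integral>u. (norm (\<Sum>t=1..n. w t *\<^sub>R \<xi> t u))\<^sup>2 \<partial>P) \<le> (\<Sum>t=1..n. 4 * (B t)\<^sup>2)" if "n \<le> T" for n
    using that
  proof (induction n)
    case (Suc n)
    define Z where "Z = (\<lambda>u. \<Sum>t=1..n. w t *\<^sub>R \<xi> t u)"
    have n: "Suc n \<in> {1..T}" "\<And>t. t \<in> {1..n} \<Longrightarrow> t \<in> {1..T}" using Suc.prems by auto
    have Zm: "Z \<in> borel_measurable P" unfolding Z_def
      by (intro borel_measurable_sum borel_measurable_scaleR \<xi>m borel_measurable_const n)
    have Zb: "norm (Z u) \<le> (\<Sum>t=1..n. 2 * B t)" if "u \<in> space P" for u
      unfolding Z_def by (intro sum_norm_le wb n that)
    have Zinv: "Z (u(\<kappa> (Suc n) := v)) = Z u" if "u \<in> space P" "v \<in> space S" for u v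
      unfolding Z_def \<xi>_def using n that by (intro sum.cong refl arg_cong2[where f=scaleR] adapted) auto
    have IH: "integrable P (\<lambda>u. (norm (Z u))\<^sup>2)" "(\<integral>u. (norm (Z u))\<^sup>2 \<partial>P) \<le> (\<Sum>t=1..n. 4 * (B t)\<^sup>2)"
      using Suc by (auto simp: Z_def)
    have last: "integrable P (\<lambda>u. (norm (w (Suc n) *\<^sub>R \<xi> (Suc n) u))\<^sup>2)"
      "(\<integral>u. (norm (w (Suc n) *\<^sub>R \<xi> (Suc n) u))\<^sup>2 \<partial>P) \<le> 4 * (B (Suc n))\<^sup>2"
    proof -
      have b: "(norm (w (Suc n) *\<^sub>R \<xi> (Suc n) u))\<^sup>2 \<le> 4 * (B (Suc n))\<^sup>2" if "u \<in> space P" for u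
        using power_mono[OF wb[OF n(1) that] norm_ge_zero, of 2] by (simp add: power_mult_distrib)
      have "(\<lambda>u. w (Suc n) *\<^sub>R \<xi> (Suc n) u) \<in> borel_measurable P"
        by (intro borel_measurable_scaleR borel_measurable_const \<xi>m[OF n(1)])
      from measurable_compose[OF this borel_measurable_norm]
      have m: "(\<lambda>u. (norm (w (Suc n) *\<^sub>R \<xi> (Suc n) u))\<^sup>2) \<in> borel_measurable P"
        by (rule borel_measurable_power)
      show i: "integrable P (\<lambda>u. (norm (w (Suc n) *\<^sub>R \<xi> (Suc n) u))\<^sup>2)"
      proof (rule integrable_const_bound[OF AE_I2 m])
        fix u assume "u \<in> space P"
        from b[OF this] show "norm ((norm (w (Suc n) *\<^sub>R \<xi> (Suc n) u))\<^sup>2) \<le> 4 * (B (Suc n))\<^sup>2" by simp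
      qed
      have "(\<integral>u. (norm (w (Suc n) *\<^sub>R \<xi> (Suc n) u))\<^sup>2 \<partial>P) \<le> (\<integral>u. 4 * (B (Suc n))\<^sup>2 \<partial>P)"
        using i b by (intro integral_mono) auto
      then show "(\<integral>u. (norm (w (Suc n) *\<^sub>R \<xi> (Suc n) u))\<^sup>2 \<partial>P) \<le> 4 * (B (Suc n))\<^sup>2" by (simp add: prob_space)
    qed
    have expand: "(norm (\<Sum>t=1..Suc n. w t *\<^sub>R \<xi> t u))\<^sup>2
        = (norm (Z u))\<^sup>2 + 2 * w (Suc n) * (Z u \<bullet> \<xi> (Suc n) u) + (norm (w (Suc n) *\<^sub>R \<xi> (Suc n) u))\<^sup>2" for u
    proof -
      have "(\<Sum>t=1..Suc n. w t *\<^sub>R \<xi> t u) = Z u + w (Suc n) *\<^sub>R \<xi> (Suc n) u" by (simp add: Z_def)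
      then show ?thesis
        by (simp only: power2_norm_eq_inner inner_add_left inner_add_right inner_scaleR_left inner_scaleR_right
            inner_commute[of "\<xi> (Suc n) u" "Z u"]) (simp add: algebra_simps)
    qed
    have orth': "integrable P (\<lambda>u. Z u \<bullet> \<xi> (Suc n) u)" "(\<integral>u. Z u \<bullet> \<xi> (Suc n) u \<partial>P) = 0"
      unfolding \<xi>_def
      by (rule centered_orthogonal[OF \<kappa>[OF n(1)] G(1)[OF n(1)] G(2)[OF n(1)] Zm Zb Zinv]; assumption)+
    have int: "integrable P (\<lambda>u. 2 * w (Suc n) * (Z u \<bullet> \<xi> (Suc n) u))"
      using orth'(1) by (rule integrable_mult_right)
    note int2 = Bochner_Integration.integrable_add[OF IH(1) int]
    have "(\<integral>u. 2 * w (Suc n) * (Z u \<bullet> \<xi> (Suc n) u) \<partial>P) = 0" using orth'(2) by simp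
    then have "(\<integral>u. (norm (Z u))\<^sup>2 + 2 * w (Suc n) * (Z u \<bullet> \<xi> (Suc n) u) + (norm (w (Suc n) *\<^sub>R \<xi> (Suc n) u))\<^sup>2 \<partial>P)
        \<le> (\<Sum>t=1..n. 4 * (B t)\<^sup>2) + 4 * (B (Suc n))\<^sup>2"
      unfolding Bochner_Integration.integral_add[OF int2 last(1)] Bochner_Integration.integral_add[OF IH(1) int]
      using IH(2) last(2) by linarith
    moreover note Bochner_Integration.integrable_add[OF int2 last(1)]
    moreover have "(\<Sum>t=1..Suc n. 4 * (B t)\<^sup>2) = (\<Sum>t=1..n. 4 * (B t)\<^sup>2) + 4 * (B (Suc n))\<^sup>2" by simp
    ultimately show ?case by (simp only: expand) 
  qed simp
  from this[of T] show "integrable P (\<lambda>u. (norm (\<Sum>t=1..T. w t *\<^sub>R centered (\<kappa> t) (G t) u))\<^sup>2)"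
    "(\<integral>u. (norm (\<Sum>t=1..T. w t *\<^sub>R centered (\<kappa> t) (G t) u))\<^sup>2 \<partial>P) \<le> (\<Sum>t=1..T. 4 * (B t)\<^sup>2)"
    by (simp_all add: \<xi>_def)
qed

end

subsection \<open>The asymmetric learning algorithm\<close>

lemma space_sphere_uniform [simp]: "space sphere_uniform = sphere 0 1"
  by (simp add: sphere_uniform_def space_restrict_space)

lemma measurable_sphere_uniform_borel: "(\<lambda>v. v) \<in> borel_measurable sphere_uniform"
  unfolding sphere_uniform_def by (rule measurable_restrict_space1) simp

lemma joint_dist_fun_upd:
  assumes "i \<in> {1..N}"
  shows "joint_dist N (z(i := a)) (z(i := b)) = norm (a - b)"
proof -
  have "(\<Sum>j\<in>{1..N}. (norm ((z(i := a)) j - (z(i := b)) j))\<^sup>2) = (\<Sum>j\<in>{1..N}. if j = i then (norm (a - b))\<^sup>2 else 0)"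
    by (rule sum.cong) auto
  also have "\<dots> = (norm (a - b))\<^sup>2" using assms by (subst sum.delta) auto
  finally show ?thesis by (simp only: joint_dist_def L2_set_def real_sqrt_abs abs_norm_cancel)
qed

lemma joint_actions_fun_upd:
  assumes "z \<in> joint_actions N X" "i \<in> {1..N}" "a \<in> X i"
  shows "z(i := a) \<in> joint_actions N X"
  using assms by (auto simp: joint_actions_def PiE_def extensional_def)

text \<open>Continuity is meant in the product topology, where only coordinates are known to be
  continuous; \<open>joint_dist\<close> is dominated by a finite sum of coordinate distances. It
  serves the Borel measurability of the costs.\<close>

lemma continuous_on_joint_lipschitz:
  fixes F :: "(nat \<Rightarrow> real^'d) \<Rightarrow> real"
  assumes "\<And>z w. z \<in> J \<Longrightarrow> w \<in> J \<Longrightarrow> \<bar>F z - F w\<bar> \<le> L * joint_dist N z w" and "L \<ge> 0"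
  shows "continuous_on J F"
  unfolding continuous_on_def
proof
  fix w assume w: "w \<in> J"
  have "((\<lambda>z. L * (\<Sum>i\<in>{1..N}. norm (z i - w i))) \<longlongrightarrow> L * (\<Sum>i\<in>{1..N}. norm (w i - w i))) (at w within J)"
  proof (intro tendsto_intros)
    fix i
    show "((\<lambda>z. z i) \<longlongrightarrow> w i) (at w within J)"
      using continuous_on_subset[OF continuous_on_product_coordinates[of i], of J] w by (simp add: continuous_on_def)
  qed
  then have null: "((\<lambda>z. L * (\<Sum>i\<in>{1..N}. norm (z i - w i))) \<longlongrightarrow> 0) (at w within J)" by simp
  have "((\<lambda>z. F z - F w) \<longlongrightarrow> 0) (at w within J)"
  proof (rule Lim_null_comparison[OF _ null])
    have "norm (F z - F w) \<le> L * (\<Sum>i\<in>{1..N}. norm (z i - w i))" if "z \<in> J" for z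
    proof -
      have "\<bar>F z - F w\<bar> \<le> L * joint_dist N z w" by (rule assms(1)[OF that w])
      also have "\<dots> \<le> L * (\<Sum>i\<in>{1..N}. norm (z i - w i))"
        unfolding joint_dist_def using assms(2) by (intro mult_left_mono L2_set_le_sum) auto
      finally show ?thesis by simp
    qed
    then show "\<forall>\<^sub>F z in at w within J. norm (F z - F w) \<le> L * (\<Sum>i\<in>{1..N}. norm (z i - w i))"
      by (simp add: eventually_at_filter)
  qed
  then show "(F \<longlongrightarrow> F w) (at w within J)" by (rule LIM_zero_cancel)
qed

text \<open>Lets the integrand of the regret, which contains an infimum over \<open>X i\<close>, be
  bounded without a proof that it is measurable: the Bochner integral of a non-integrable function
  is 0, and \<open>K\<close> is nonnegative.\<close>

lemma integral_upper_bound: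
  assumes "integrable M H" "\<And>u. u \<in> space M \<Longrightarrow> R u \<le> H u" "(\<integral>u. H u \<partial>M) \<le> K" "(0::real) \<le> K"
  shows "(\<integral>u. R u \<partial>M) \<le> K"
proof (cases "integrable M R")
  case True
  then show ?thesis using integral_mono[OF True assms(1,2)] assms(3) by linarith
next
  case False
  then show ?thesis using assms(4) by (simp add: not_integrable_integral_eq)
qed

text \<open>A constant of its own, since the simplifier rewrites the 1 in \<open>{1..}\<close> to \<open>Suc 0\<close> inside the
  index set of the product measure.\<close>

definition coords :: "nat \<Rightarrow> (nat \<times> nat) set" where
  "coords Nz = {1..Nz} \<times> {1..}"

text \<open>\<open>T\<close> is fixed because differentiability is assumed only at actions played up
  to episode \<open>T\<close>; measurability is proved only that far.\<close>

locale convex_game =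
  fixes D r U L0 :: real and N Nz :: nat
    and X :: "nat \<Rightarrow> (real^'d) set" and C :: "nat \<Rightarrow> (nat \<Rightarrow> real^'d) \<Rightarrow> real"
    and x1 :: "nat \<Rightarrow> real^'d" and \<delta> \<eta>z \<eta>f :: "nat \<Rightarrow> real" and T :: nat
  assumes pos: "D > 0" "r > 0" "U > 0" "L0 > 0"
    and Nz: "Nz \<le> N"
    and X: "\<And>i. i \<in> {1..N} \<Longrightarrow> closed (X i) \<and> convex (X i) \<and> cball 0 r \<subseteq> X i \<and> bounded (X i) \<and> diameter (X i) \<le> D"
    and convex_cost: "\<And>i z. i \<in> {1..N} \<Longrightarrow> z \<in> joint_actions N X \<Longrightarrow> convex_on (X i) (\<lambda>a. C i (z(i := a)))"
    and bounded_cost: "\<And>i z. i \<in> {1..N} \<Longrightarrow> z \<in> joint_actions N X \<Longrightarrow> \<bar>C i z\<bar> \<le> U"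
    and lipschitz_cost: "\<And>i z w. i \<in> {1..N} \<Longrightarrow> z \<in> joint_actions N X \<Longrightarrow> w \<in> joint_actions N X \<Longrightarrow>
      \<bar>C i z - C i w\<bar> \<le> L0 * joint_dist N z w"
    and \<delta>: "\<And>t. t \<ge> 1 \<Longrightarrow> \<delta> t = 1 / (real Nz powr (1/4) * real t powr (1/4))"
    and \<eta>z: "\<And>t. t \<ge> 1 \<Longrightarrow> \<eta>z t = 1 / (real Nz powr (1/4) * real t powr (3/4))"
    and \<eta>f: "\<And>t. t \<ge> 1 \<Longrightarrow> \<eta>f t = 1 / sqrt (real t)"
    and x1: "x1 \<in> joint_actions N X"
    and \<delta>_less: "\<And>t. Nz \<ge> 1 \<Longrightarrow> t \<ge> 1 \<Longrightarrow> \<delta> t < r"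
    and x1_shrunk: "\<And>i. i \<in> {1..Nz} \<Longrightarrow> x1 i \<in> shrunk r (\<delta> 1) (X i)"
    and T: "T \<ge> 1"
    and differentiable: "\<And>u t i. u \<in> space (directions Nz) \<Longrightarrow> t \<in> {1..T} \<Longrightarrow> i \<in> {Nz+1..N} \<Longrightarrow>
      (\<lambda>a. C i ((played r N Nz X C \<delta> \<eta>z \<eta>f x1 u t)(i := a))) differentiable
        (at (played r N Nz X C \<delta> \<eta>z \<eta>f x1 u t i) within X i)"
begin

sublocale iid_product "coords Nz" "sphere_uniform :: (real^'d) measure"
  by (rule iid_product.intro) (rule prob_space_sphere_uniform)

lemma directions_eq: "directions Nz = P" by (simp add: directions_def coords_def)

definition "x t u = iterate r N Nz X C \<delta> \<eta>z \<eta>f x1 u t"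
definition "y t u = played r N Nz X C \<delta> \<eta>z \<eta>f x1 u t"

section \<open>Feasibility of the iterates and of the played actions\<close>

lemma X_facts:
  assumes "i \<in> {1..N}"
  shows "closed (X i)" "convex (X i)" "cball 0 r \<subseteq> X i" "bounded (X i)" "0 \<in> X i" "X i \<noteq> {}" "interior (X i) \<noteq> {}"
proof -
  show "closed (X i)" "convex (X i)" and sub: "cball 0 r \<subseteq> X i" and "bounded (X i)" using X[OF assms] by auto
  have "0 \<in> cball (0::real^'d) r" "0 \<in> ball (0::real^'d) r" using pos by auto
  then show "0 \<in> X i" "X i \<noteq> {}" "interior (X i) \<noteq> {}"
    using sub interior_mono[OF sub] by (auto simp only: interior_cball)
qed

lemma X_dist: "i \<in> {1..N} \<Longrightarrow> a \<in> X i \<Longrightarrow> b \<in> X i \<Longrightarrow> norm (a - b) \<le> D"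
  using diameter_bounded_bound[of "X i" a b] X[of i] by (auto simp: dist_norm)

lemma X_norm: "i \<in> {1..N} \<Longrightarrow> a \<in> X i \<Longrightarrow> norm a \<le> D"
  using X_dist[of i a 0] X_facts[of i] by simp

lemma \<delta>_pos: "Nz \<ge> 1 \<Longrightarrow> t \<ge> 1 \<Longrightarrow> \<delta> t > 0" by (simp add: \<delta>)

lemma \<delta>_antimono: "Nz \<ge> 1 \<Longrightarrow> s \<ge> 1 \<Longrightarrow> s \<le> t \<Longrightarrow> \<delta> t \<le> \<delta> s"
  by (auto simp: \<delta> intro!: divide_left_mono mult_left_mono powr_mono2 mult_pos_pos)

lemma y_nth:
  assumes "i \<in> {1..N}"
  shows "y t u i = (if i \<le> Nz then x t u i + \<delta> t *\<^sub>R u (i, t) else x t u i)"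
  using assms by (simp add: y_def played_def perturb_def x_def)

lemma y_ext: "i \<notin> {1..N} \<Longrightarrow> y t u i = undefined"
  by (auto simp: y_def played_def perturb_def)

lemma x_1: "x (Suc 0) u = x1" by (simp add: x_def)

lemma x_Suc_ext: "t \<ge> 1 \<Longrightarrow> i \<notin> {1..N} \<Longrightarrow> x (Suc t) u i = undefined"
  by (simp only: x_def iterate.simps update_def Let_def restrict_apply if_False if_True) auto

lemma x_Suc_z:
  assumes "t \<ge> 1" "i \<in> {1..Nz}"
  shows "x (Suc t) u i = closest_point (shrunk r (\<delta> t) (X i))
    (x t u i - \<eta>z t *\<^sub>R ((real CARD('d) / \<delta> t * C i (y t u)) *\<^sub>R u (i, t)))"
  using assms Nz by (simp add: x_def y_def played_def update_def Let_def)

lemma x_Suc_f: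
  assumes "t \<ge> 1" "i \<in> {Nz+1..N}"
  shows "x (Suc t) u i = closest_point (X i)
    (x t u i - \<eta>f t *\<^sub>R gradient_within (\<lambda>a. C i ((y t u)(i := a))) (y t u i) (X i))"
  using assms Nz by (simp add: x_def y_def played_def update_def Let_def)

lemma shrunk_facts:
  assumes "t \<ge> 1" "i \<in> {1..Nz}"
  shows "closed (shrunk r (\<delta> t) (X i))" "convex (shrunk r (\<delta> t) (X i))" "0 \<in> shrunk r (\<delta> t) (X i)"
    "shrunk r (\<delta> t) (X i) \<noteq> {}" "shrunk r (\<delta> t) (X i) \<subseteq> X i"
proof -
  have "i \<in> {1..N}" using assms Nz by auto
  note Xi = X_facts[OF this]
  show "closed (shrunk r (\<delta> t) (X i))" "convex (shrunk r (\<delta> t) (X i))"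
    by (intro shrunk_closed shrunk_convex Xi)+
  show "0 \<in> shrunk r (\<delta> t) (X i)" "shrunk r (\<delta> t) (X i) \<subseteq> X i" using Xi(5) by (auto simp: shrunk_def)
  then show "shrunk r (\<delta> t) (X i) \<noteq> {}" by blast
qed

text \<open>The update of episode \<open>t\<close> projects with \<open>\<delta> t\<close>, but the
  next perturbation has size \<open>\<delta> (Suc t)\<close>. Monotonicity of the shrunken sets
  bridges this off-by-one.\<close>

lemma x_mem:
  assumes "t \<ge> 1"
  shows "x t u \<in> joint_actions N X" "i \<in> {1..Nz} \<Longrightarrow> x t u i \<in> shrunk r (\<delta> t) (X i)"
proof -
  have "x t u \<in> joint_actions N X \<and> (\<forall>i\<in>{1..Nz}. x t u i \<in> shrunk r (\<delta> t) (X i))"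
    using assms
  proof (induction t rule: dec_induct)
    case base
    then show ?case using x1 x1_shrunk by (simp add: x_1)
  next
    case (step t)
    have z: "x (Suc t) u i \<in> shrunk r (\<delta> (Suc t)) (X i)" if i: "i \<in> {1..Nz}" for i
    proof -
      have "x (Suc t) u i \<in> shrunk r (\<delta> t) (X i)"
        unfolding x_Suc_z[OF step(1) i] using shrunk_facts[OF step(1) i] by (intro closest_point_in_set)
      moreover have "shrunk r (\<delta> t) (X i) \<subseteq> shrunk r (\<delta> (Suc t)) (X i)"
      proof (rule shrunk_mono)
        have "i \<in> {1..N}" using i Nz by auto
        from X_facts[OF this] show "convex (X i)" "0 \<in> X i" by blast+
      qed (use i step(1) in \<open>auto intro: \<delta>_pos \<delta>_antimono \<delta>_less\<close>)
      ultimately show ?thesis by blast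
    qed
    have "x (Suc t) u i \<in> X i" if i: "i \<in> {1..N}" for i
    proof (cases "i \<le> Nz")
      case True
      then show ?thesis using z[of i] shrunk_facts(5)[of "Suc t" i] i by auto
    next
      case False
      then have "i \<in> {Nz+1..N}" using i by auto
      then show ?thesis
        by (subst x_Suc_f[OF step(1)]) (auto intro!: closest_point_in_set X_facts[OF i])
    qed
    then show ?case using z x_Suc_ext[OF step(1)] by (auto simp: joint_actions_def PiE_def extensional_def)
  qed
  then show "x t u \<in> joint_actions N X" "i \<in> {1..Nz} \<Longrightarrow> x t u i \<in> shrunk r (\<delta> t) (X i)" by auto
qed

lemma x_mem_X: "t \<ge> 1 \<Longrightarrow> i \<in> {1..N} \<Longrightarrow> x t u i \<in> X i"
  using x_mem(1)[of t u] unfolding joint_actions_def by (rule PiE_mem)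

lemma cball_x_subset: "t \<ge> 1 \<Longrightarrow> i \<in> {1..Nz} \<Longrightarrow> a \<in> shrunk r (\<delta> t) (X i) \<Longrightarrow> cball a (\<delta> t) \<subseteq> X i"
  by (rule cball_subset_of_shrunk[OF X_facts(2,3) \<delta>_pos \<delta>_less]) (use Nz in auto)

lemma direction_norm:
  assumes "u \<in> space P" "i \<in> {1..Nz}" "t \<ge> 1"
  shows "norm (u (i, t)) = 1"
  using assms by (auto simp: space_PiM PiE_def Pi_iff coords_def)

lemma y_mem:
  assumes u: "u \<in> space P" and t: "t \<ge> 1"
  shows "y t u \<in> joint_actions N X"
proof -
  have "y t u i \<in> X i" if i: "i \<in> {1..N}" for i
  proof (cases "i \<le> Nz")
    case True
    then have i': "i \<in> {1..Nz}" using i by auto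
    have "y t u i \<in> cball (x t u i) (\<delta> t)"
      using True \<delta>_pos[of t] direction_norm[OF u i' t] i' t by (simp add: y_nth[OF i] dist_norm)
    then show ?thesis using cball_x_subset[OF t i' x_mem(2)[OF t i']] by blast
  qed (use x_mem_X[OF t i] in \<open>simp add: y_nth[OF i]\<close>)
  then show ?thesis by (auto simp: joint_actions_def PiE_def extensional_def y_ext)
qed

lemma y_mem_X: "u \<in> space P \<Longrightarrow> t \<ge> 1 \<Longrightarrow> i \<in> {1..N} \<Longrightarrow> y t u i \<in> X i"
  using y_mem[of u t] unfolding joint_actions_def by (rule PiE_mem)

lemma cost_lipschitz_own:
  assumes "z \<in> joint_actions N X" "i \<in> {1..N}" "a \<in> X i" "b \<in> X i"
  shows "\<bar>C i (z(i := a)) - C i (z(i := b))\<bar> \<le> L0 * norm (a - b)"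
  using lipschitz_cost[OF assms(2) joint_actions_fun_upd[OF assms(1,2,3)] joint_actions_fun_upd[OF assms(1,2,4)]]
  by (simp only: joint_dist_fun_upd[OF assms(2)])

lemma differentiable_y:
  "u \<in> space P \<Longrightarrow> t \<in> {1..T} \<Longrightarrow> i \<in> {Nz+1..N} \<Longrightarrow>
    (\<lambda>a. C i ((y t u)(i := a))) differentiable (at (y t u i) within X i)"
  using differentiable[of u t i] by (simp add: y_def directions_eq)

section \<open>Regret of the first-order agents\<close>

lemma regret_eq:
  "regret r N Nz X C \<delta> \<eta>z \<eta>f x1 i T =
    (\<integral>u. (\<Sum>t=1..T. C i (y t u)) - (INF a\<in>X i. \<Sum>t=1..T. C i ((y t u)(i := a))) \<partial>P)"
  by (simp add: regret_def y_def directions_eq)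

lemma regret_integrand_le:
  assumes "i \<in> {1..N}" "\<And>a. a \<in> X i \<Longrightarrow> (\<Sum>t=1..T. C i (y t u) - C i ((y t u)(i := a))) \<le> B"
  shows "(\<Sum>t=1..T. C i (y t u)) - (INF a\<in>X i. \<Sum>t=1..T. C i ((y t u)(i := a))) \<le> B"
proof -
  have "(\<Sum>t=1..T. C i (y t u)) - B \<le> (INF a\<in>X i. \<Sum>t=1..T. C i ((y t u)(i := a)))"
    using assms(2) X_facts(6)[OF assms(1)] by (intro cINF_greatest) (auto simp: sum_subtractf algebra_simps)
  then show ?thesis by simp
qed

text \<open>Agent \<open>i\<close> does not perturb its own block, so the observed gradient is exact
  at its iterate, given the actions the others played.\<close>

lemma first_order_regret:
  assumes i: "i \<in> {Nz+1..N}"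
  shows "regret r N Nz X C \<delta> \<eta>z \<eta>f x1 i T \<le> (D\<^sup>2 + L0\<^sup>2) * real T powr (1/2)"
  unfolding regret_eq
proof (rule integral_upper_bound)
  let ?K = "(D\<^sup>2 + L0\<^sup>2) * real T powr (1/2)"
  show "integrable P (\<lambda>_. ?K)" by (rule integrable_const)
  show "(\<integral>u. ?K \<partial>P) \<le> ?K" by (simp add: prob_space)
  show "0 \<le> ?K" by simp
  fix u assume u: "u \<in> space P"
  have i': "i \<in> {1..N}" using i by auto
  note Xi = X_facts[OF i']
  show "(\<Sum>t=1..T. C i (y t u)) - (INF a\<in>X i. \<Sum>t=1..T. C i ((y t u)(i := a))) \<le> ?K"
  proof (rule regret_integrand_le[OF i'])
    fix a assume a: "a \<in> X i"
    define W where "W t = (norm (x t u i - a))\<^sup>2" for t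
    have step: "C i (y t u) - C i ((y t u)(i := a)) \<le> sqrt (real t) / 2 * (W t - W (Suc t)) + L0\<^sup>2 / 2 * real t powr (1/2 - 1)"
      if t: "t \<in> {1..T}" for t
    proof -
      let ?f = "\<lambda>b. C i ((y t u)(i := b))"
      let ?g = "gradient_within ?f (y t u i) (X i)"
      have t1: "t \<ge> 1" using t by simp
      have yx: "y t u i = x t u i" using i by (simp add: y_nth[OF i'])
      note yX = y_mem_X[OF u t1 i'] and yJ = y_mem[OF u t1]
      note diff = differentiable_y[OF u t i]
      have "C i (y t u) - ?f a = ?f (y t u i) - ?f a" by simp
      also have "\<dots> \<le> ?g \<bullet> (y t u i - a)"
        by (rule convex_gradient_within_le[OF Xi(2,7) yX diff a convex_cost[OF i' yJ]])
      also have "\<dots> = ?g \<bullet> (x t u i - a)" by (simp only: yx)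
      also have "\<dots> \<le> (W t - W (Suc t)) / (2 * \<eta>f t) + \<eta>f t / 2 * (norm ?g)\<^sup>2"
        unfolding W_def x_Suc_f[OF t1 i] using t1 by (intro projected_gradient_step Xi a) (simp add: \<eta>f)
      also have "\<dots> \<le> (W t - W (Suc t)) / (2 * \<eta>f t) + \<eta>f t / 2 * L0\<^sup>2"
      proof -
        have "norm ?g \<le> L0"
          by (rule gradient_within_norm_le[OF Xi(2,3) yX diff pos(2)]) (rule cost_lipschitz_own[OF yJ i'])
        then show ?thesis using t1 by (intro add_left_mono mult_left_mono power_mono) (auto simp: \<eta>f)
      qed
      also have "\<dots> = sqrt (real t) / 2 * (W t - W (Suc t)) + L0\<^sup>2 / 2 * real t powr (1/2 - 1)"
        using t1 by (simp add: \<eta>f powr_minus_divide powr_half_sqrt mult.commute)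
      finally show ?thesis .
    qed
    have "(\<Sum>t=1..T. C i (y t u) - C i ((y t u)(i := a)))
        \<le> (\<Sum>t=1..T. sqrt (real t) / 2 * (W t - W (Suc t)) + L0\<^sup>2 / 2 * real t powr (1/2 - 1))"
      by (rule sum_mono) (rule step)
    also have "\<dots> = (\<Sum>t=1..T. sqrt (real t) / 2 * (W t - W (Suc t))) + L0\<^sup>2 / 2 * (\<Sum>t=1..T. real t powr (1/2 - 1))"
      by (simp only: sum.distrib sum_distrib_left)
    \<comment> \<open>The weights are \<open>1 / (2 * \<eta>f t)\<close>, and the squared distances
      to the comparator are at most the square of \<open>D\<close>.\<close>
    also have "\<dots> \<le> sqrt (real T) / 2 * D\<^sup>2 + L0\<^sup>2 / 2 * (real T powr (1/2) / (1/2))"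
    proof (intro add_mono mult_left_mono sum_powr_le)
      show "(\<Sum>t=1..T. sqrt (real t) / 2 * (W t - W (Suc t))) \<le> sqrt (real T) / 2 * D\<^sup>2"
      proof (rule weighted_telescope_bound)
        fix t :: nat assume "t \<ge> 1"
        then show "W t \<le> D\<^sup>2" unfolding W_def using X_dist[OF i' x_mem_X[OF _ i'] a] by (intro power_mono) auto
      qed (use T in \<open>auto simp: W_def\<close>)
    qed (use T in auto)
    also have "\<dots> \<le> ?K"
      by (simp add: powr_half_sqrt algebra_simps)
    finally show "(\<Sum>t=1..T. C i (y t u) - C i ((y t u)(i := a))) \<le> ?K" .
  qed
qed

section \<open>Measurability of the iterates\<close>

lemma measurable_cost:
  assumes i: "i \<in> {1..N}" and Y: "\<And>j. j \<in> {1..N} \<Longrightarrow> (\<lambda>u. Y u j) \<in> borel_measurable P"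
    and mem: "\<And>u. u \<in> space P \<Longrightarrow> Y u \<in> joint_actions N X"
  shows "(\<lambda>u. C i (Y u)) \<in> borel_measurable P"
proof -
  have Ym: "Y \<in> borel_measurable P"
  proof (rule measurable_coordinatewise_then_product)
    fix j
    show "(\<lambda>u. Y u j) \<in> borel_measurable P"
    proof (cases "j \<in> {1..N}")
      case False
      have "Y u j = undefined" if "u \<in> space P" for u
        by (rule PiE_arb[OF mem[OF that, unfolded joint_actions_def] False])
      then have "(\<lambda>u. Y u j) \<in> borel_measurable P \<longleftrightarrow> (\<lambda>u. undefined :: real^'d) \<in> borel_measurable P"
        by (rule measurable_cong)
      then show ?thesis by simp
    qed (rule Y)
  qed
  \<comment> \<open>The cost is controlled only on joint actions, so the measurability argument
    passes through the Borel space restricted to that set.\<close>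
  have "continuous_on (joint_actions N X) (C i)"
    by (rule continuous_on_joint_lipschitz[OF lipschitz_cost[OF i]]) (use pos in auto)
  then have "C i \<in> borel_measurable (restrict_space borel (joint_actions N X))"
    by (rule borel_measurable_continuous_on_restrict)
  moreover have "Y \<in> measurable P (restrict_space borel (joint_actions N X))"
    by (rule measurable_restrict_space2[OF _ Ym]) (use mem in auto)
  ultimately show ?thesis by (rule measurable_compose[rotated])
qed

lemma measurable_direction:
  assumes "i \<in> {1..Nz}" "t \<ge> 1"
  shows "(\<lambda>u. u (i, t)) \<in> borel_measurable P"
proof -
  have "(\<lambda>u. u (i, t)) \<in> measurable P sphere_uniform"
    by (rule measurable_component_singleton) (use assms in \<open>auto simp: coords_def\<close>)
  from measurable_compose[OF this measurable_sphere_uniform_borel] show ?thesis .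
qed

lemma measurable_y_if:
  assumes t: "t \<ge> 1" and x: "\<And>j. j \<in> {1..N} \<Longrightarrow> (\<lambda>u. x t u j) \<in> borel_measurable P" and j: "j \<in> {1..N}"
  shows "(\<lambda>u. y t u j) \<in> borel_measurable P"
proof (cases "j \<le> Nz")
  case True
  have "(\<lambda>u. x t u j + \<delta> t *\<^sub>R u (j, t)) \<in> borel_measurable P"
    by (intro borel_measurable_add borel_measurable_scaleR borel_measurable_const x[OF j] measurable_direction t)
      (use j True in auto)
  then show ?thesis using True by (simp only: y_nth[OF j] if_True)
next
  case False
  then show ?thesis using x[OF j] by (simp only: y_nth[OF j] if_False)
qed

text \<open>A definite description gives no measurability by itself. The gradient is recovered as a
  pointwise limit of difference quotients of measurable costs towards fixed points \<open>b\<close>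
  of \<open>X i\<close>.\<close>

lemma measurable_cost_gradient:
  assumes t: "t \<in> {1..T}" and i: "i \<in> {Nz+1..N}"
    and y: "\<And>j. j \<in> {1..N} \<Longrightarrow> (\<lambda>u. y t u j) \<in> borel_measurable P"
  shows "(\<lambda>u. gradient_within (\<lambda>a. C i ((y t u)(i := a))) (y t u i) (X i)) \<in> borel_measurable P"
proof -
  define g where "g u = gradient_within (\<lambda>a. C i ((y t u)(i := a))) (y t u i) (X i)" for u
  have i': "i \<in> {1..N}" and t1: "t \<ge> 1" using i t by auto
  note Xi = X_facts[OF i']
  have dir: "(\<lambda>u. (b - y t u i) \<bullet> g u) \<in> borel_measurable P" if b: "b \<in> X i" for b
  proof (rule borel_measurable_LIMSEQ_metric[where f="\<lambda>n u. real (Suc n) *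
        (C i ((y t u)(i := y t u i + (b - y t u i) /\<^sub>R real (Suc n))) - C i ((y t u)(i := y t u i)))"])
    let ?p = "\<lambda>n u. y t u i + (b - y t u i) /\<^sub>R real (Suc n)"
    fix n
    have p: "?p n \<in> borel_measurable P"
      by (intro borel_measurable_add borel_measurable_scaleR borel_measurable_diff borel_measurable_const y[OF i'])
    have upd: "(\<lambda>u. C i ((y t u)(i := q u))) \<in> borel_measurable P"
      if q: "q \<in> borel_measurable P" "\<And>u. u \<in> space P \<Longrightarrow> q u \<in> X i" for q
    proof (rule measurable_cost[OF i'])
      fix j assume j: "j \<in> {1..N}"
      show "(\<lambda>u. ((y t u)(i := q u)) j) \<in> borel_measurable P"
      proof (cases "j = i")
        case True
        then show ?thesis using q(1) by (simp only: fun_upd_same)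
      next
        case False
        then show ?thesis using y[OF j] by (simp only: fun_upd_other not_False_eq_True)
      qed
    next
      fix u assume u: "u \<in> space P"
      show "(y t u)(i := q u) \<in> joint_actions N X"
        by (rule joint_actions_fun_upd[OF y_mem[OF u t1] i' q(2)[OF u]])
    qed
    have "(\<lambda>u. C i ((y t u)(i := ?p n u))) \<in> borel_measurable P"
      by (rule upd[OF p]) (rule segment_point_in[OF Xi(2) y_mem_X[OF _ t1 i'] b])
    moreover have "(\<lambda>u. C i ((y t u)(i := y t u i))) \<in> borel_measurable P"
      by (rule upd[OF y[OF i']]) (rule y_mem_X[OF _ t1 i'])
    ultimately show "(\<lambda>u. real (Suc n) * (C i ((y t u)(i := ?p n u)) - C i ((y t u)(i := y t u i)))) \<in> borel_measurable P"
      by (intro borel_measurable_times borel_measurable_diff borel_measurable_const)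
  next
    fix u assume u: "u \<in> space P"
    show "(\<lambda>n. real (Suc n) * (C i ((y t u)(i := y t u i + (b - y t u i) /\<^sub>R real (Suc n))) - C i ((y t u)(i := y t u i))))
        \<longlonglongrightarrow> (b - y t u i) \<bullet> g u"
      unfolding g_def
      by (rule gradient_within_difference_quotient[OF Xi(2,7) y_mem_X[OF u t1 i'] differentiable_y[OF u t i] b])
  qed
  \<comment> \<open>A coordinate is obtained by subtracting the limit for 0 from the one for
    \<open>r *\<^sub>R b\<close>; the random base point cancels.\<close>
  have "(\<lambda>u. g u \<bullet> b) \<in> borel_measurable P" if "b \<in> Basis" for b :: "real^'d"
  proof -
    have "r *\<^sub>R b \<in> X i" using Xi(3) pos that by (auto simp: subset_iff)
    from borel_measurable_diff[OF dir[OF this] dir[OF Xi(5)]]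
    have "(\<lambda>u. r * (b \<bullet> g u)) \<in> borel_measurable P" by (simp add: inner_diff_left)
    from borel_measurable_times[OF borel_measurable_const[of "1 / r"] this]
    have "(\<lambda>u. 1 / r * (r * (b \<bullet> g u))) \<in> borel_measurable P" .
    moreover have "1 / r * (r * (b \<bullet> g u)) = g u \<bullet> b" for u using pos by (simp add: inner_commute)
    ultimately show ?thesis by (simp only:)
  qed
  then have "\<forall>b\<in>Basis. (\<lambda>u. g u \<bullet> b) \<in> borel_measurable P" by blast
  from borel_measurable_euclidean_space[THEN iffD2, OF this] have "g \<in> borel_measurable P" .
  then show ?thesis unfolding g_def[abs_def] .
qed

lemma measurable_closest_point:
  fixes S :: "(real^'d) set"
  assumes "closed S" "convex S" "S \<noteq> {}" "q \<in> borel_measurable P"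
  shows "(\<lambda>u. closest_point S (q u)) \<in> borel_measurable P"
  by (rule measurable_compose[OF assms(4) borel_measurable_continuous_onI[OF continuous_on_closest_point[OF assms(2,1,3)]]])

text \<open>All coordinates are treated at once, since each update sees the whole joint action
  through a cost or a gradient.\<close>

lemma measurable_x:
  assumes "t \<ge> 1" "t \<le> T" "j \<in> {1..N}"
  shows "(\<lambda>u. x t u j) \<in> borel_measurable P"
  using assms
proof (induction t arbitrary: j rule: dec_induct)
  case base
  then show ?case by (simp add: x_1)
next
  case (step t)
  have t: "t \<in> {1..T}" using step by auto
  have x: "\<And>j. j \<in> {1..N} \<Longrightarrow> (\<lambda>u. x t u j) \<in> borel_measurable P" using step by auto
  have y: "\<And>j. j \<in> {1..N} \<Longrightarrow> (\<lambda>u. y t u j) \<in> borel_measurable P" by (rule measurable_y_if[OF step(1) x])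
  show ?case
  proof (cases "j \<le> Nz")
    case True
    then have j: "j \<in> {1..Nz}" using step by auto
    have c: "(\<lambda>u. C j (y t u)) \<in> borel_measurable P"
      by (rule measurable_cost[OF step.prems(2) y y_mem[OF _ step(1)]])
    show ?thesis unfolding x_Suc_z[OF step(1) j]
      by (intro measurable_closest_point shrunk_facts[OF step(1) j] borel_measurable_diff borel_measurable_scaleR
          borel_measurable_times borel_measurable_const c x[OF step.prems(2)] measurable_direction[OF j step(1)])
  next
    case False
    then have j: "j \<in> {Nz+1..N}" using step by auto
    show ?thesis unfolding x_Suc_f[OF step(1) j]
      by (intro measurable_closest_point X_facts[OF step.prems(2)] borel_measurable_diff borel_measurable_scaleR
          borel_measurable_const x[OF step.prems(2)] measurable_cost_gradient[OF t j y])
  qed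
qed

lemma measurable_y: "t \<ge> 1 \<Longrightarrow> t \<le> T \<Longrightarrow> j \<in> {1..N} \<Longrightarrow> (\<lambda>u. y t u j) \<in> borel_measurable P"
  by (rule measurable_y_if[OF _ measurable_x])

text \<open>The iterate of episode \<open>t\<close> uses directions of earlier episodes only.
  Allowing \<open>t = s\<close> matters: it makes the iterate orthogonal to the noise of its own
  episode. Played actions satisfy only the strict version.\<close>

lemma x_adapted: "t \<le> s \<Longrightarrow> x t (u((i, s) := v)) = x t u"
proof (induction t)
  case (Suc t)
  then show ?case by (auto simp: x_def)
qed (simp add: x_def)

lemma y_adapted: "t < s \<Longrightarrow> y t (u((i, s) := v)) = y t u"
  using x_adapted[of t s u i v] by (simp add: y_def played_def x_def)

lemma y_own_direction:
  assumes "i \<in> {1..Nz}"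
  shows "y t (u((i, t) := v)) = (y t u)(i := x t u i + \<delta> t *\<^sub>R v)"
proof
  fix j
  have i: "i \<in> {1..N}" using assms Nz by auto
  show "y t (u((i, t) := v)) j = ((y t u)(i := x t u i + \<delta> t *\<^sub>R v)) j"
  proof (cases "j \<in> {1..N}")
    case True
    then show ?thesis using assms x_adapted[of t t u i v] by (simp add: y_nth)
  next
    case False
    moreover have "j \<noteq> i" using False i by blast
    ultimately show ?thesis by (simp only: y_ext fun_upd_other not_False_eq_True)
  qed
qed

section \<open>The zeroth-order estimate and its noise\<close>

definition "grad_est i t u = (real CARD('d) / \<delta> t * C i (y t u)) *\<^sub>R u (i, t)"

definition "noise i t = centered (i, t) (grad_est i t)"

lemma measurable_grad_est:
  assumes "i \<in> {1..Nz}" "t \<in> {1..T}"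
  shows "grad_est i t \<in> borel_measurable P"
proof -
  have i: "i \<in> {1..N}" and t: "t \<ge> 1" "t \<le> T" using assms Nz by auto
  have "(\<lambda>u. C i (y t u)) \<in> borel_measurable P"
    by (rule measurable_cost[OF i measurable_y[OF t] y_mem[OF _ t(1)]])
  then show ?thesis unfolding grad_est_def[abs_def]
    by (intro borel_measurable_scaleR borel_measurable_times borel_measurable_const measurable_direction[OF assms(1) t(1)])
qed

lemma norm_grad_est_le:
  assumes "i \<in> {1..Nz}" "t \<ge> 1" "u \<in> space P"
  shows "norm (grad_est i t u) \<le> real CARD('d) * U / \<delta> t"
proof -
  have i: "i \<in> {1..N}" and Nz1: "Nz \<ge> 1" using assms Nz by auto
  have "norm (grad_est i t u) = real CARD('d) / \<delta> t * \<bar>C i (y t u)\<bar>"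
    using \<delta>_pos[OF Nz1 assms(2)] direction_norm[OF assms(3,1,2)] by (simp add: grad_est_def abs_mult)
  also have "\<dots> \<le> real CARD('d) / \<delta> t * U"
    using \<delta>_pos[OF Nz1 assms(2)] bounded_cost[OF i y_mem[OF assms(3,2)]] by (intro mult_left_mono) auto
  finally show ?thesis by simp
qed

text \<open>The mean inside \<open>noise\<close> resamples episode \<open>s\<close>, while the
  change is made at the later episode \<open>t\<close>; updates of distinct coordinates
  commute.\<close>

lemma noise_adapted:
  assumes "s < t"
  shows "noise i s (u((i, t) := v)) = noise i s u"
proof -
  have g: "grad_est i s (w((i, t) := v)) = grad_est i s w" for w
    using assms by (simp add: grad_est_def y_adapted)
  have "u((i, t) := v, (i, s) := w) = u((i, s) := w, (i, t) := v)" for w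
    using assms by (intro fun_upd_twist) auto
  then show ?thesis by (simp only: noise_def centered_def g)
qed

text \<open>Conditionally on everything but its own direction, the mean of the one-point estimate is an
  approximate subgradient at the unperturbed action.\<close>

lemma grad_est_mean_le:
  assumes i: "i \<in> {1..Nz}" and t: "t \<in> {1..T}" and u: "u \<in> space P" and a: "a \<in> shrunk r (\<delta> t) (X i)"
  defines "m \<equiv> \<integral>v. grad_est i t (u((i, t) := v)) \<partial>sphere_uniform"
  shows "C i ((y t u)(i := x t u i)) - C i ((y t u)(i := a)) - 2 * L0 * \<delta> t \<le> m \<bullet> (x t u i - a)"
proof -
  have i': "i \<in> {1..N}" and t1: "t \<ge> 1" and Nz1: "Nz \<ge> 1" and k: "(i, t) \<in> coords Nz" using i t Nz by (auto simp: coords_def)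
  note Xi = X_facts[OF i'] and d = \<delta>_pos[OF Nz1 t1] and yJ = y_mem[OF u t1]
  have sub: "cball (x t u i) (\<delta> t) \<subseteq> X i" "cball a (\<delta> t) \<subseteq> X i"
    using cball_x_subset[OF t1 i] x_mem(2)[OF t1 i] a by blast+
  \<comment> \<open>Composing with the projection extends the cost from \<open>X i\<close> to the
    whole space. Since projection is nonexpansive the constant \<open>L0\<close> survives, and on
    \<open>X i\<close>, where convexity is known, nothing changes.\<close>
  define f where "f = (\<lambda>b. C i ((y t u)(i := closest_point (X i) b)))"
  have fX: "f b = C i ((y t u)(i := b))" if "b \<in> X i" for b using that by (simp add: f_def closest_point_self)
  have lip: "\<bar>f b - f c\<bar> \<le> L0 * norm (b - c)" for b c
  proof -
    have "\<bar>f b - f c\<bar> \<le> L0 * norm (closest_point (X i) b - closest_point (X i) c)"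
      unfolding f_def by (intro cost_lipschitz_own yJ i' closest_point_in_set Xi)
    also have "\<dots> \<le> L0 * norm (b - c)"
      using closest_point_lipschitz[OF Xi(2,1,6), of b c] pos by (intro mult_left_mono) (auto simp: dist_norm)
    finally show ?thesis .
  qed
  have conv: "convex_on (X i) f"
  proof -
    have "convex_on (X i) (\<lambda>b. C i ((y t u)(i := b)))" by (rule convex_cost[OF i' yJ])
    then show ?thesis using Xi(2) unfolding convex_on_def by (auto simp: fX convexD)
  qed
  have int: "integrable sphere_uniform (\<lambda>v. grad_est i t (u((i, t) := v)))"
    by (rule integrable_section[OF k measurable_grad_est[OF i t] norm_grad_est_le[OF i t1] u])
  have "m \<bullet> (a - x t u i) = (\<integral>v. grad_est i t (u((i, t) := v)) \<bullet> (a - x t u i) \<partial>sphere_uniform)"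
    unfolding m_def using int by simp
  also have "\<dots> = (\<integral>v. real CARD('d) / \<delta> t * (f (x t u i + \<delta> t *\<^sub>R v) * (v \<bullet> (a - x t u i))) \<partial>sphere_uniform)"
  proof (rule Bochner_Integration.integral_cong[OF refl])
    fix v :: "real^'d" assume "v \<in> space sphere_uniform"
    then have "x t u i + \<delta> t *\<^sub>R v \<in> X i" using sub(1) d by (auto simp: subset_iff dist_norm)
    then show "grad_est i t (u((i, t) := v)) \<bullet> (a - x t u i)
        = real CARD('d) / \<delta> t * (f (x t u i + \<delta> t *\<^sub>R v) * (v \<bullet> (a - x t u i)))"
      by (simp add: grad_est_def y_own_direction[OF i] fX)
  qed
  also have "\<dots> = real CARD('d) / \<delta> t * (\<integral>v. f (x t u i + \<delta> t *\<^sub>R v) * (v \<bullet> (a - x t u i)) \<partial>sphere_uniform)"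
    by simp
  also have "\<dots> \<le> f a - f (x t u i) + 2 * L0 * \<delta> t"
    by (rule one_point_gradient_estimate[OF conv lip d sub])
  finally have "m \<bullet> (a - x t u i) \<le> f a - f (x t u i) + 2 * L0 * \<delta> t" .
  moreover have "f a = C i ((y t u)(i := a))" using sub(2) d by (intro fX) (auto simp: subset_iff)
  moreover have "f (x t u i) = C i ((y t u)(i := x t u i))" by (rule fX[OF x_mem_X[OF t1 i']])
  ultimately show ?thesis by (simp only: inner_diff_right)
qed

section \<open>Regret of the zeroth-order agents\<close>

definition "rate = real Nz powr (1/4) * real T powr (3/4)"

text \<open>Three replacements cost multiples of \<open>\<delta> t\<close>: the played action by the
  iterate (\<open>L0\<close>), the comparator \<open>a\<close> by its shrunken copy
  (\<open>L0 * D / r\<close>), and the cost difference by the mean estimate (\<open>2 * L0\<close>).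
  The second summand of \<open>W\<close> pays for the motion of the comparator, and the noise is
  split into a part along the iterate and a part linear in \<open>a\<close>.\<close>

lemma zeroth_order_step:
  assumes i: "i \<in> {1..Nz}" and t: "t \<in> {1..T}" and u: "u \<in> space P" and a: "a \<in> X i"
  defines "W \<equiv> \<lambda>t. (norm (x t u i - (1 - \<delta> t / r) *\<^sub>R a))\<^sup>2 + 2 * D\<^sup>2 / r * \<delta> t"
  shows "C i (y t u) - C i ((y t u)(i := a))
    \<le> real Nz powr (1/4) * real t powr (3/4) / 2 * (W t - W (Suc t))
      + (3 * L0 + L0 * D / r + (real CARD('d) * U)\<^sup>2 / 2) * (real Nz powr (1/4) * real t powr (3/4 - 1))
      - x t u i \<bullet> noise i t u + ((1 - \<delta> t / r) *\<^sub>R noise i t u) \<bullet> a"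
proof -
  have i': "i \<in> {1..N}" and t1: "t \<ge> 1" and t1': "Suc t \<ge> 1" and Nz1: "Nz \<ge> 1" using i t Nz by auto
  note Xi = X_facts[OF i'] and yJ = y_mem[OF u t1]
  define n where "n = real Nz powr (1/4)"
  define d where "d = \<delta> t"
  define b where "b = (\<lambda>t. (1 - \<delta> t / r) *\<^sub>R a)"
  define g where "g = grad_est i t u"
  define m where "m = (\<integral>v. grad_est i t (u((i, t) := v)) \<partial>sphere_uniform)"
  have n1: "n \<ge> 1" unfolding n_def using Nz1 by (simp add: ge_one_powr_ge_zero)
  have d: "d > 0" "d < r" unfolding d_def using \<delta>_pos[OF Nz1 t1] \<delta>_less[OF Nz1 t1] by auto
  have d': "\<delta> (Suc t) \<le> d" "\<delta> (Suc t) > 0"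
    unfolding d_def using \<delta>_antimono[OF Nz1 t1, of "Suc t"] \<delta>_pos[OF Nz1 t1'] by auto
  have bs: "b s \<in> shrunk r (\<delta> s) (X i)" if "s \<ge> 1" for s
    unfolding b_def by (rule scaleR_mem_shrunk[OF Xi(2,5) a \<delta>_pos[OF Nz1 that] \<delta>_less[OF Nz1 that]])
  have bX: "b s \<in> X i" if "s \<ge> 1" for s using bs[OF that] shrunk_facts(5)[OF that i] by blast
  have noise: "noise i t u = g - m" by (simp add: noise_def centered_def g_def m_def)

  have perturbation: "C i (y t u) - C i ((y t u)(i := x t u i)) \<le> L0 * d"
  proof -
    have "\<bar>C i ((y t u)(i := y t u i)) - C i ((y t u)(i := x t u i))\<bar> \<le> L0 * norm (y t u i - x t u i)"
      by (rule cost_lipschitz_own[OF yJ i' y_mem_X[OF u t1 i'] x_mem_X[OF t1 i']])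
    moreover have "norm (y t u i - x t u i) = d"
      using i d direction_norm[OF u i t1] by (simp add: y_nth[OF i'] d_def)
    ultimately show ?thesis by simp
  qed
  have shrinking: "C i ((y t u)(i := b t)) - C i ((y t u)(i := a)) \<le> L0 * D / r * d"
  proof -
    have "\<bar>C i ((y t u)(i := b t)) - C i ((y t u)(i := a))\<bar> \<le> L0 * norm (b t - a)"
      by (rule cost_lipschitz_own[OF yJ i' bX[OF t1] a])
    moreover have "norm (b t - a) = d / r * norm a"
      using d pos by (simp add: b_def d_def scaleR_diff_left)
    moreover have "L0 * (d / r * norm a) \<le> L0 * (d / r * D)"
      using X_norm[OF i' a] d pos by (intro mult_left_mono) auto
    ultimately show ?thesis by (simp add: mult_ac)
  qed
  have mean: "C i ((y t u)(i := x t u i)) - C i ((y t u)(i := b t)) \<le> m \<bullet> (x t u i - b t) + 2 * L0 * d"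
    using grad_est_mean_le[OF i t u bs[OF t1]] by (simp add: m_def d_def)

  \<comment> \<open>The comparator moves by at most \<open>(d - \<delta> (Suc t)) / r * D\<close>
    and distances are at most \<open>D\<close>, so the squared distance changes by at most
    \<open>2 * D\<close> times this, which is the decrease of the second summand of
    \<open>W\<close>.\<close>
  have drift: "(norm (x t u i - b t))\<^sup>2 - (norm (x (Suc t) u i - b t))\<^sup>2 \<le> W t - W (Suc t)"
  proof -
    define p where "p = norm (x (Suc t) u i - b (Suc t))"
    define q where "q = norm (x (Suc t) u i - b t)"
    have pq: "0 \<le> p" "0 \<le> q" "p \<le> D" "q \<le> D"
      unfolding p_def q_def using X_dist[OF i' x_mem_X[OF t1' i'] bX] t1 by auto
    have "p - q \<le> norm (b t - b (Suc t))"
      unfolding p_def q_def using norm_triangle_ineq[of "x (Suc t) u i - b t" "b t - b (Suc t)"] by simp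
    also have "b t - b (Suc t) = (- ((d - \<delta> (Suc t)) / r)) *\<^sub>R a"
      by (simp add: b_def d_def scaleR_diff_left[symmetric] diff_divide_distrib)
    also have "norm \<dots> \<le> (d - \<delta> (Suc t)) / r * D"
      using d' pos X_norm[OF i' a] by (simp add: mult_left_mono divide_right_mono)
    finally have "p - q \<le> (d - \<delta> (Suc t)) / r * D" .
    then have "(p - q) * (p + q) \<le> (d - \<delta> (Suc t)) / r * D * (2 * D)"
      using pq d' pos by (intro mult_mono) auto
    then have "p\<^sup>2 - q\<^sup>2 \<le> 2 * D\<^sup>2 / r * d - 2 * D\<^sup>2 / r * \<delta> (Suc t)"
      by (simp add: power2_eq_square algebra_simps diff_divide_distrib)
    then show ?thesis unfolding W_def p_def q_def b_def d_def by linarith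
  qed
  have descent: "g \<bullet> (x t u i - b t) \<le> (W t - W (Suc t)) / (2 * \<eta>z t) + \<eta>z t / 2 * (real CARD('d) * U / d)\<^sup>2"
  proof -
    have \<eta>: "\<eta>z t > 0" using Nz1 t1 by (simp add: \<eta>z)
    have "g \<bullet> (x t u i - b t)
      \<le> ((norm (x t u i - b t))\<^sup>2 - (norm (x (Suc t) u i - b t))\<^sup>2) / (2 * \<eta>z t) + \<eta>z t / 2 * (norm g)\<^sup>2"
      unfolding x_Suc_z[OF t1 i] grad_est_def[symmetric] g_def
      by (rule projected_gradient_step[OF shrunk_facts(1,2)[OF t1 i] bs[OF t1] \<eta>])
    also have "\<dots> \<le> (W t - W (Suc t)) / (2 * \<eta>z t) + \<eta>z t / 2 * (real CARD('d) * U / d)\<^sup>2"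
      unfolding g_def d_def
      using drift \<eta> norm_grad_est_le[OF i t1 u]
      by (intro add_mono divide_right_mono mult_left_mono power_mono) auto
    finally show ?thesis .
  qed
  have dn: "d = 1 / (n * real t powr (1/4))" using t1 by (simp add: d_def n_def \<delta>)
  \<comment> \<open>\<open>\<delta> t\<close> has \<open>n\<close> in the denominator;
    \<open>n \<ge> 1\<close> allows it to be moved to the numerator, to match the term from the
    squared estimates.\<close>
  have d_le: "d \<le> n * real t powr (3/4 - 1)"
  proof -
    have "1 / n \<le> n" using n1 order_trans[of "1/n" 1 n] by simp
    then have "1 / n * real t powr (- (1/4)) \<le> n * real t powr (- (1/4))" by (rule mult_right_mono) simp
    then show ?thesis by (simp add: dn powr_minus_divide)
  qed
  have eta: "\<eta>z t / 2 * (real CARD('d) * U / d)\<^sup>2 = (real CARD('d) * U)\<^sup>2 / 2 * (n * real t powr (3/4 - 1))"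
  proof -
    define \<tau> where "\<tau> = real t powr (1/4)"
    have \<tau>: "\<tau> > 0" "real t powr (3/4) = \<tau> ^ 3" "real t powr (3/4 - 1) = 1 / \<tau>"
      using t1 by (auto simp: \<tau>_def powr_powr powr_minus_divide simp flip: powr_realpow)
    have e: "\<eta>z t = 1 / (n * \<tau> ^ 3)" using t1 by (simp add: \<eta>z n_def \<tau>)
    have d\<tau>: "d = 1 / (n * \<tau>)" by (simp add: dn \<tau>_def)
    show ?thesis unfolding e \<tau>(3) d\<tau> using \<tau>(1) n1 by (simp add: power2_eq_square power3_eq_cube field_simps)
  qed
  have inv_eta: "(W t - W (Suc t)) / (2 * \<eta>z t) = n * real t powr (3/4) / 2 * (W t - W (Suc t))"
    using t1 by (simp add: \<eta>z n_def)
  have "C i (y t u) - C i ((y t u)(i := a)) \<le> m \<bullet> (x t u i - b t) + (3 * L0 + L0 * D / r) * d"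
    using perturbation shrinking mean by (simp add: distrib_right)
  also have "(3 * L0 + L0 * D / r) * d \<le> (3 * L0 + L0 * D / r) * (n * real t powr (3/4 - 1))"
    using d_le pos by (intro mult_left_mono) auto
  \<comment> \<open>The descent inequality holds for the sampled estimate \<open>g\<close>, the
    convexity inequality for its mean \<open>m\<close>; their difference is the noise.\<close>
  also have "m \<bullet> (x t u i - b t) = g \<bullet> (x t u i - b t) - x t u i \<bullet> noise i t u + ((1 - \<delta> t / r) *\<^sub>R noise i t u) \<bullet> a"
  proof -
    have "m = g - noise i t u" by (simp add: noise)
    moreover have "noise i t u \<bullet> b t = ((1 - \<delta> t / r) *\<^sub>R noise i t u) \<bullet> a" by (simp add: b_def)
    ultimately show ?thesis
      by (simp only: inner_diff_left inner_diff_right inner_commute[of "x t u i" "noise i t u"])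
  qed
  also note descent
  finally show ?thesis unfolding inv_eta eta n_def[symmetric] distrib_right by linarith
qed

text \<open>Cauchy-Schwarz with \<open>norm a \<le> D\<close> makes the right side independent of
  \<open>a\<close>, so the infimum over comparators can be taken before integrating. The bound for
  \<open>W\<close> is three times the square of \<open>D\<close>, as \<open>\<delta> t < r\<close>;
  \<open>4 / 3\<close> is the inverse of the exponent in \<open>sum_powr_le\<close>.\<close>

lemma zeroth_order_pointwise:
  assumes i: "i \<in> {1..Nz}" and u: "u \<in> space P" and a: "a \<in> X i"
  shows "(\<Sum>t=1..T. C i (y t u) - C i ((y t u)(i := a)))
    \<le> (3 / 2 * D\<^sup>2 + 4 / 3 * (3 * L0 + L0 * D / r + (real CARD('d) * U)\<^sup>2 / 2)) * rate
      - (\<Sum>t=1..T. x t u i \<bullet> noise i t u) + D * norm (\<Sum>t=1..T. (1 - \<delta> t / r) *\<^sub>R noise i t u)"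
proof -
  have i': "i \<in> {1..N}" and Nz1: "Nz \<ge> 1" using i Nz by auto
  note Xi = X_facts[OF i']
  define W where "W t = (norm (x t u i - (1 - \<delta> t / r) *\<^sub>R a))\<^sup>2 + 2 * D\<^sup>2 / r * \<delta> t" for t
  define n where "n = real Nz powr (1/4)"
  define c where "c = 3 * L0 + L0 * D / r + (real CARD('d) * U)\<^sup>2 / 2"
  have "c \<ge> 0" using pos by (simp add: c_def)
  have "n > 0" using Nz1 by (simp add: n_def)
  have W: "0 \<le> W t" "W t \<le> 3 * D\<^sup>2" if t: "t \<ge> 1" for t
  proof -
    note \<delta>t = \<delta>_pos[OF Nz1 t] \<delta>_less[OF Nz1 t]
    show "0 \<le> W t" using \<delta>t pos by (simp add: W_def)
    have "(1 - \<delta> t / r) *\<^sub>R a \<in> X i" using \<delta>t by (intro scaleR_mem_convex_zero Xi a) auto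
    from power_mono[OF X_dist[OF i' x_mem_X[OF t i'] this] norm_ge_zero, where n=2]
    have "(norm (x t u i - (1 - \<delta> t / r) *\<^sub>R a))\<^sup>2 \<le> D\<^sup>2" .
    moreover have "2 * D\<^sup>2 / r * \<delta> t \<le> 2 * D\<^sup>2 / r * r" using \<delta>t pos by (intro mult_left_mono) auto
    moreover have "2 * D\<^sup>2 / r * r = 2 * D\<^sup>2" using pos by simp
    ultimately show "W t \<le> 3 * D\<^sup>2" unfolding W_def by linarith
  qed
  have "(\<Sum>t=1..T. C i (y t u) - C i ((y t u)(i := a)))
      \<le> (\<Sum>t=1..T. n * real t powr (3/4) / 2 * (W t - W (Suc t)) + c * (n * real t powr (3/4 - 1))
          - x t u i \<bullet> noise i t u + ((1 - \<delta> t / r) *\<^sub>R noise i t u) \<bullet> a)"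
    unfolding W_def n_def c_def by (intro sum_mono zeroth_order_step i u a)
  also have "\<dots> = (\<Sum>t=1..T. n * real t powr (3/4) / 2 * (W t - W (Suc t)))
      + c * (n * (\<Sum>t=1..T. real t powr (3/4 - 1)))
      - (\<Sum>t=1..T. x t u i \<bullet> noise i t u) + (\<Sum>t=1..T. (1 - \<delta> t / r) *\<^sub>R noise i t u) \<bullet> a"
    by (simp only: sum.distrib sum_subtractf sum_distrib_left inner_sum_left)
  also have "\<dots> \<le> n * real T powr (3/4) / 2 * (3 * D\<^sup>2) + c * (n * (real T powr (3/4) / (3/4)))
      - (\<Sum>t=1..T. x t u i \<bullet> noise i t u) + D * norm (\<Sum>t=1..T. (1 - \<delta> t / r) *\<^sub>R noise i t u)"
  proof (intro add_mono diff_right_mono mult_left_mono sum_powr_le T)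
    show "(\<Sum>t=1..T. n * real t powr (3/4) / 2 * (W t - W (Suc t))) \<le> n * real T powr (3/4) / 2 * (3 * D\<^sup>2)"
      using \<open>n > 0\<close> W T
      by (intro weighted_telescope_bound) (auto intro!: divide_right_mono mult_left_mono powr_mono2)
    have "(\<Sum>t=1..T. (1 - \<delta> t / r) *\<^sub>R noise i t u) \<bullet> a
        \<le> norm (\<Sum>t=1..T. (1 - \<delta> t / r) *\<^sub>R noise i t u) * norm a" by (rule norm_cauchy_schwarz)
    also have "\<dots> \<le> norm (\<Sum>t=1..T. (1 - \<delta> t / r) *\<^sub>R noise i t u) * D"
      by (rule mult_left_mono[OF X_norm[OF i' a] norm_ge_zero])
    finally show "(\<Sum>t=1..T. (1 - \<delta> t / r) *\<^sub>R noise i t u) \<bullet> a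
        \<le> D * norm (\<Sum>t=1..T. (1 - \<delta> t / r) *\<^sub>R noise i t u)" by (simp only: mult.commute)
  qed (use \<open>c \<ge> 0\<close> \<open>n > 0\<close> in auto)
  also have "n * real T powr (3/4) / 2 * (3 * D\<^sup>2) + c * (n * (real T powr (3/4) / (3/4)))
      = (3 / 2 * D\<^sup>2 + 4 / 3 * c) * rate"
    by (simp add: rate_def n_def algebra_simps)
  finally show ?thesis unfolding c_def .
qed

lemma zeroth_order_regret:
  assumes i: "i \<in> {1..Nz}"
  shows "regret r N Nz X C \<delta> \<eta>z \<eta>f x1 i T
    \<le> (3 / 2 * D\<^sup>2 + 4 / 3 * (3 * L0 + L0 * D / r + (real CARD('d) * U)\<^sup>2 / 2)
        + D * (1 / 2 + 2 * (real CARD('d) * U)\<^sup>2)) * rate"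
proof -
  have i': "i \<in> {1..N}" and Nz1: "Nz \<ge> 1" using i Nz by auto
  define K where "K = 3 / 2 * D\<^sup>2 + 4 / 3 * (3 * L0 + L0 * D / r + (real CARD('d) * U)\<^sup>2 / 2)"
  define V where "V = (real CARD('d) * U)\<^sup>2"
  define Z where "Z u = (\<Sum>t=1..T. (1 - \<delta> t / r) *\<^sub>R noise i t u)" for u
  \<comment> \<open>An integrable majorant: \<open>D * norm (Z u)\<close> is split by the
    arithmetic-geometric mean inequality at scale \<open>rate\<close>, so the second moment suffices
    and no root of an expectation is taken. The two halves give \<open>D / 2\<close> and
    \<open>2 * D * V\<close> times \<open>rate\<close>.\<close>
  define H where "H u = (K * rate + D * rate / 2) - (\<Sum>t=1..T. x t u i \<bullet> noise i t u) + D / (2 * rate) * (norm (Z u))\<^sup>2" for u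
  have rate: "rate > 0" using Nz1 T by (simp add: rate_def)
  have K: "K \<ge> 0" using pos by (simp add: K_def)
  have key: "(i, t) \<in> coords Nz" if "t \<in> {1..T}" for t using i that by (simp add: coords_def)
  have weight: "\<bar>1 - \<delta> t / r\<bar> \<le> 1" if "t \<in> {1..T}" for t
    using \<delta>_pos[OF Nz1, of t] \<delta>_less[OF Nz1, of t] that by (auto simp: abs_le_iff)
  have bounded: "norm (grad_est i t u) \<le> real CARD('d) * U / \<delta> t" if "t \<in> {1..T}" "u \<in> space P" for t u
    using norm_grad_est_le[OF i _ that(2), of t] that(1) by simp
  have adapted: "centered (i, s) (grad_est i s) (u((i, t) := v)) = centered (i, s) (grad_est i s) u" if "s < t" for s t u v
    using noise_adapted[OF that, of i] by (simp only: noise_def)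
  have Z2: "integrable P (\<lambda>u. (norm (Z u))\<^sup>2)"
    "(\<integral>u. (norm (Z u))\<^sup>2 \<partial>P) \<le> (\<Sum>t=1..T. 4 * (real CARD('d) * U / \<delta> t)\<^sup>2)"
    unfolding Z_def noise_def
    by (rule centered_sum_second_moment[where \<kappa>="\<lambda>t. (i, t)" and B="\<lambda>t. real CARD('d) * U / \<delta> t"];
      rule key measurable_grad_est[OF i] bounded weight adapted; assumption)+
  have moment: "(\<integral>u. (norm (Z u))\<^sup>2 \<partial>P) \<le> 4 * V * rate\<^sup>2"
  proof -
    \<comment> \<open>\<open>\<delta> t\<close> decreases, so each of the \<open>T\<close> summands
      is at most the last one.\<close>
    have "4 * (real CARD('d) * U / \<delta> t)\<^sup>2 \<le> 4 * V * ((real Nz powr (1/4))\<^sup>2 * real T powr (1/2))" if t: "t \<in> {1..T}" for t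
    proof -
      have "(real CARD('d) * U / \<delta> t)\<^sup>2 = V * ((real Nz powr (1/4))\<^sup>2 * (real t powr (1/4))\<^sup>2)"
        using t by (simp add: \<delta> V_def power_mult_distrib mult_ac)
      also have "(real t powr (1/4))\<^sup>2 = real t powr (1/2)"
        using t by (simp add: powr_powr flip: powr_realpow)
      finally have eq: "(real CARD('d) * U / \<delta> t)\<^sup>2 = V * ((real Nz powr (1/4))\<^sup>2 * real t powr (1/2))" .
      have "V * ((real Nz powr (1/4))\<^sup>2 * real t powr (1/2)) \<le> V * ((real Nz powr (1/4))\<^sup>2 * real T powr (1/2))"
        using t by (intro mult_left_mono powr_mono2) (auto simp: V_def)
      then show ?thesis unfolding eq by simp
    qed
    from sum_mono[of "{1..T}", OF this]
    have "(\<Sum>t=1..T. 4 * (real CARD('d) * U / \<delta> t)\<^sup>2) \<le> real T * (4 * V * ((real Nz powr (1/4))\<^sup>2 * real T powr (1/2)))"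
      by simp
    also have "\<dots> = 4 * V * rate\<^sup>2"
    proof -
      have "(real T powr (3/4))\<^sup>2 = real T powr (3/2)" using T by (simp add: powr_powr flip: powr_realpow)
      also have "\<dots> = real T * real T powr (1/2)" using T powr_add[of "real T" 1 "1/2"] by simp
      finally show ?thesis by (simp add: rate_def power_mult_distrib)
    qed
    finally show ?thesis using Z2(2) by linarith
  qed
  \<comment> \<open>The iterate of episode \<open>t\<close> does not depend on the direction of
    agent \<open>i\<close> in that episode, so this part of the noise has mean 0.\<close>
  have orth: "integrable P (\<lambda>u. x t u i \<bullet> noise i t u)" "(\<integral>u. x t u i \<bullet> noise i t u \<partial>P) = 0" if t: "t \<in> {1..T}" for t
  proof -
    have t1: "t \<ge> 1" "t \<le> T" using t by auto
    note co = centered_orthogonal[OF key[OF t] measurable_grad_est[OF i t] norm_grad_est_le[OF i t1(1)]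
        measurable_x[OF t1 i'] X_norm[OF i' x_mem_X[OF t1(1) i']]]
    show "integrable P (\<lambda>u. x t u i \<bullet> noise i t u)" "(\<integral>u. x t u i \<bullet> noise i t u \<partial>P) = 0"
      unfolding noise_def by (rule co; simp add: x_adapted)+
  qed
  have int1: "integrable P (\<lambda>u. \<Sum>t=1..T. x t u i \<bullet> noise i t u)"
    using orth(1) by (rule Bochner_Integration.integrable_sum)
  have int2: "integrable P (\<lambda>u. (K * rate + D * rate / 2) - (\<Sum>t=1..T. x t u i \<bullet> noise i t u))"
    by (rule Bochner_Integration.integrable_diff[OF integrable_const int1])
  have int3: "integrable P (\<lambda>u. D / (2 * rate) * (norm (Z u))\<^sup>2)"
    by (rule integrable_mult_right[OF Z2(1)])
  have H: "integrable P H" unfolding H_def[abs_def] by (rule Bochner_Integration.integrable_add[OF int2 int3])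
  have "(\<integral>u. (\<Sum>t=1..T. x t u i \<bullet> noise i t u) \<partial>P) = 0"
    using orth by (subst Bochner_Integration.integral_sum) auto
  then have "(\<integral>u. H u \<partial>P) = (K * rate + D * rate / 2) + D / (2 * rate) * (\<integral>u. (norm (Z u))\<^sup>2 \<partial>P)"
    unfolding H_def Bochner_Integration.integral_add[OF int2 int3]
      Bochner_Integration.integral_diff[OF integrable_const int1]
    by (simp add: prob_space)
  also have "\<dots> \<le> (K * rate + D * rate / 2) + D / (2 * rate) * (4 * V * rate\<^sup>2)"
    using moment rate pos by (intro add_left_mono mult_left_mono) auto
  also have "\<dots> = (K + D * (1 / 2 + 2 * V)) * rate"
    using rate by (simp add: power2_eq_square field_simps)
  finally have bound: "(\<integral>u. H u \<partial>P) \<le> (K + D * (1 / 2 + 2 * V)) * rate" .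
  have "regret r N Nz X C \<delta> \<eta>z \<eta>f x1 i T \<le> (K + D * (1 / 2 + 2 * V)) * rate"
    unfolding regret_eq
  proof (rule integral_upper_bound[OF H _ bound])
    show "0 \<le> (K + D * (1 / 2 + 2 * V)) * rate" using K pos rate by (simp add: V_def)
    fix u assume u: "u \<in> space P"
    show "(\<Sum>t=1..T. C i (y t u)) - (INF a\<in>X i. \<Sum>t=1..T. C i ((y t u)(i := a))) \<le> H u"
    proof (rule regret_integrand_le[OF i'])
      fix a assume a: "a \<in> X i"
      have "norm (Z u) \<le> rate / 2 + (norm (Z u))\<^sup>2 / (2 * rate)"
        using rate sum_squares_bound[of "norm (Z u)" rate] by (simp add: field_simps power2_eq_square)
      then have "D * norm (Z u) \<le> D * (rate / 2 + (norm (Z u))\<^sup>2 / (2 * rate))"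
        using pos by (intro mult_left_mono) auto
      then have "D * norm (Z u) \<le> D * rate / 2 + D / (2 * rate) * (norm (Z u))\<^sup>2"
        by (simp add: distrib_left)
      then show "(\<Sum>t=1..T. C i (y t u) - C i ((y t u)(i := a))) \<le> H u"
        using zeroth_order_pointwise[OF i u a] unfolding H_def K_def Z_def by linarith
    qed
  qed
  then show ?thesis unfolding K_def V_def .
qed

end

theorem theorem1:
  fixes D r U L0 :: real
  assumes "D > 0" "r > 0" "U > 0" "L0 > 0"
  shows "\<exists>K>0. \<forall>N Nz (X :: nat \<Rightarrow> (real^'d) set) C x1 \<delta> \<eta>z \<eta>f T.
    Nz \<le> N \<longrightarrow>
    (\<forall>i\<in>{1..N}. closed (X i) \<and> convex (X i) \<and> cball 0 r \<subseteq> X i \<and>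
                bounded (X i) \<and> diameter (X i) \<le> D) \<longrightarrow>
    (\<forall>i\<in>{1..N}. \<forall>x\<in>joint_actions N X. convex_on (X i) (\<lambda>a. C i (x(i := a)))) \<longrightarrow>
    (\<forall>i\<in>{1..N}. \<forall>x\<in>joint_actions N X. \<bar>C i x\<bar> \<le> U) \<longrightarrow>
    (\<forall>i\<in>{1..N}. \<forall>x\<in>joint_actions N X. \<forall>y\<in>joint_actions N X.
       \<bar>C i x - C i y\<bar> \<le> L0 * joint_dist N x y) \<longrightarrow>
    (\<forall>t\<ge>1. \<delta> t = 1 / (real Nz powr (1/4) * real t powr (1/4))) \<longrightarrow>
    (\<forall>t\<ge>1. \<eta>z t = 1 / (real Nz powr (1/4) * real t powr (3/4))) \<longrightarrow>
    (\<forall>t\<ge>1. \<eta>f t = 1 / sqrt (real t)) \<longrightarrow>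
    x1 \<in> joint_actions N X \<longrightarrow>
    (Nz \<ge> 1 \<longrightarrow> (\<forall>t\<ge>1. \<delta> t < r) \<and> (\<forall>i\<in>{1..Nz}. x1 i \<in> shrunk r (\<delta> 1) (X i))) \<longrightarrow>
    T \<ge> 1 \<longrightarrow>
    (\<forall>u\<in>space (directions Nz). \<forall>t\<in>{1..T}. \<forall>i\<in>{Nz+1..N}.
       let y = played r N Nz X C \<delta> \<eta>z \<eta>f x1 u t
       in (\<lambda>a. C i (y(i := a))) differentiable (at (y i) within X i)) \<longrightarrow>
    (\<forall>i\<in>{1..Nz}. regret r N Nz X C \<delta> \<eta>z \<eta>f x1 i T
                    \<le> K * (real Nz powr (1/4) * real T powr (3/4))) \<and>
    (\<forall>i\<in>{Nz+1..N}. regret r N Nz X C \<delta> \<eta>z \<eta>f x1 i T \<le> K * real T powr (1/2))"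
proof -
  \<comment> \<open>Both constants are formed from the dimension and \<open>D\<close>,
    \<open>r\<close>, \<open>U\<close>, \<open>L0\<close> before the game is introduced; their
    maximum serves both kinds of agents.\<close>
  define K where "K = 3 / 2 * D\<^sup>2 + 4 / 3 * (3 * L0 + L0 * D / r + (real CARD('d) * U)\<^sup>2 / 2)
    + D * (1 / 2 + 2 * (real CARD('d) * U)\<^sup>2)"
  define K' where "K' = D\<^sup>2 + L0\<^sup>2"
  have K: "K > 0" "K' > 0"
    using assms by (auto simp: K_def K'_def intro!: add_pos_pos add_pos_nonneg)
  show ?thesis
  proof (intro exI[of _ "max K K'"] conjI allI impI)
    show "max K K' > 0" using K by simp
  next
    fix N Nz :: nat and X :: "nat \<Rightarrow> (real^'d) set" and C x1 and \<delta> \<eta>z \<eta>f :: "nat \<Rightarrow> real" and T :: nat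
    assume *: "Nz \<le> N"
      "\<forall>i\<in>{1..N}. closed (X i) \<and> convex (X i) \<and> cball 0 r \<subseteq> X i \<and> bounded (X i) \<and> diameter (X i) \<le> D"
      "\<forall>i\<in>{1..N}. \<forall>x\<in>joint_actions N X. convex_on (X i) (\<lambda>a. C i (x(i := a)))"
      "\<forall>i\<in>{1..N}. \<forall>x\<in>joint_actions N X. \<bar>C i x\<bar> \<le> U"
      "\<forall>i\<in>{1..N}. \<forall>x\<in>joint_actions N X. \<forall>y\<in>joint_actions N X. \<bar>C i x - C i y\<bar> \<le> L0 * joint_dist N x y"
      "\<forall>t\<ge>1. \<delta> t = 1 / (real Nz powr (1/4) * real t powr (1/4))"
      "\<forall>t\<ge>1. \<eta>z t = 1 / (real Nz powr (1/4) * real t powr (3/4))"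
      "\<forall>t\<ge>1. \<eta>f t = 1 / sqrt (real t)"
      "x1 \<in> joint_actions N X"
      "Nz \<ge> 1 \<longrightarrow> (\<forall>t\<ge>1. \<delta> t < r) \<and> (\<forall>i\<in>{1..Nz}. x1 i \<in> shrunk r (\<delta> 1) (X i))"
      "T \<ge> 1"
      "\<forall>u\<in>space (directions Nz). \<forall>t\<in>{1..T}. \<forall>i\<in>{Nz+1..N}.
        let y = played r N Nz X C \<delta> \<eta>z \<eta>f x1 u t
        in (\<lambda>a. C i (y(i := a))) differentiable (at (y i) within X i)"
    have game: "convex_game D r U L0 N Nz X C x1 \<delta> \<eta>z \<eta>f T"
    proof (rule convex_game.intro)
      show "x1 i \<in> shrunk r (\<delta> 1) (X i)" if "i \<in> {1..Nz}" for i
        using *(10) that by (meson atLeastAtMost_iff order_trans)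
      show "(\<lambda>a. C i ((played r N Nz X C \<delta> \<eta>z \<eta>f x1 u t)(i := a))) differentiable
          (at (played r N Nz X C \<delta> \<eta>z \<eta>f x1 u t i) within X i)"
        if "u \<in> space (directions Nz)" "t \<in> {1..T}" "i \<in> {Nz+1..N}" for u t i
        using *(12) that unfolding Let_def by blast
    qed (use assms * in blast)+
    interpret convex_game D r U L0 N Nz X C x1 \<delta> \<eta>z \<eta>f T by (rule game)
    show "\<forall>i\<in>{1..Nz}. regret r N Nz X C \<delta> \<eta>z \<eta>f x1 i T \<le> max K K' * (real Nz powr (1/4) * real T powr (3/4))"
    proof
      fix i assume "i \<in> {1..Nz}"
      from zeroth_order_regret[OF this]
      have "regret r N Nz X C \<delta> \<eta>z \<eta>f x1 i T \<le> K * rate" unfolding K_def .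
      also have "\<dots> \<le> max K K' * rate" by (intro mult_right_mono) (auto simp: rate_def)
      finally show "regret r N Nz X C \<delta> \<eta>z \<eta>f x1 i T \<le> max K K' * (real Nz powr (1/4) * real T powr (3/4))"
        unfolding rate_def .
    qed
    show "\<forall>i\<in>{Nz+1..N}. regret r N Nz X C \<delta> \<eta>z \<eta>f x1 i T \<le> max K K' * real T powr (1/2)"
    proof
      fix i assume "i \<in> {Nz+1..N}"
      from first_order_regret[OF this]
      have "regret r N Nz X C \<delta> \<eta>z \<eta>f x1 i T \<le> K' * real T powr (1/2)" unfolding K'_def .
      also have "\<dots> \<le> max K K' * real T powr (1/2)" by (intro mult_right_mono) auto
      finally show "regret r N Nz X C \<delta> \<eta>z \<eta>f x1 i T \<le> max K K' * real T powr (1/2)" .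
    qed
  qed
qed

end
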